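(* Let $0<a<1$, $\alpha>-1$ and $\phi(z)=az+(1-a)$. Then the sequence $\{\widetilde{C_\phi}^{(n)}\}_{n\ge0}$ of iterated Aluthge transforms of the composition operator $C_\phi$ on $\mathcal{A}_\alpha^2(\mathbb{D})$ converges to $0$ in the strong operator topology, but fails to converge in the norm topology.
   Context: $\mathbb{D}$ is the open unit disk in $\mathbb{C}$. For $\alpha>-1$, the weighted Bergman space $\mathcal{A}_\alpha^2(\mathbb{D})$ is the Hilbert space of analytic functions $f(z)=\sum_{n\ge0}a_nz^n$ on $\mathbb{D}$ with $\sum_n \frac{n!\,\Gamma(\alpha+2)}{\Gamma(n+\alpha+2)}|a_n|^2<\infty$, with inner product $\langle \sum a_nz^n,\sum b_nz^n\rangle=\sum_{n}\frac{n!\,\Gamma(\alpha+2)}{\Gamma(n+\alpha+2)}a_n\overline{b_n}$. For an analytic self-map $\phi$ of $\mathbb{D}$, $C_\phi h=h\circ\phi$, a bounded operator on $\mathcal{A}_\alpha^2(\mathbb{D})$. For a bounded operator $T$ on a Hilbert space $H$, let $|T|=(T^*T)^{1/2}$ and let $T=U|T|$ be the polar decomposition, $U$ being the partial isometry with $\ker U=\ker T=\ker|T|$. The Aluthge transform of $T$ is $\widetilde{T}=|T|^{1/2}U|T|^{1/2}$. The iterated Aluthge transforms are $\widetilde{T}^{(0)}=T$ and $\widetilde{T}^{(n+1)}=\widetilde{(\widetilde{T}^{(n)})}$ for every integer $n\ge0$. *)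

theory Defs
  imports "HOL-Complex_Analysis.Complex_Analysis"
begin

text \<open>
  Hilbert spaces are given by a carrier and an inner product, because the
  weighted Bergman spaces depend on a real parameter. The elements are complex-valued
  functions and the vector space operations are the pointwise ones. The inner product is
  linear in its first argument.
\<close>

record 'x hspace =
  hcarrier :: "('x \<Rightarrow> complex) set"
  hinner :: "('x \<Rightarrow> complex) \<Rightarrow> ('x \<Rightarrow> complex) \<Rightarrow> complex"

type_synonym 'x operator = "('x \<Rightarrow> complex) \<Rightarrow> ('x \<Rightarrow> complex)"

definition hnorm :: "'x hspace \<Rightarrow> ('x \<Rightarrow> complex) \<Rightarrow> real" where
  "hnorm H f = sqrt (Re (hinner H f f))"

text \<open>
  Operators are total functions that vanish off the carrier. Two operators
  that agree on the carrier are therefore equal, which makes the descriptions by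
  \<open>THE\<close> below meaningful, and composition of operators is plain function composition.
\<close>

definition bounded_op :: "'x hspace \<Rightarrow> 'x operator \<Rightarrow> bool" where
  "bounded_op H T \<longleftrightarrow>
     (\<forall>f\<in>hcarrier H. T f \<in> hcarrier H) \<and>
     (\<forall>f. f \<notin> hcarrier H \<longrightarrow> T f = (\<lambda>_. 0)) \<and>
     (\<forall>f\<in>hcarrier H. \<forall>g\<in>hcarrier H. T (\<lambda>x. f x + g x) = (\<lambda>x. T f x + T g x)) \<and>
     (\<forall>c. \<forall>f\<in>hcarrier H. T (\<lambda>x. c * f x) = (\<lambda>x. c * T f x)) \<and>
     (\<exists>K. \<forall>f\<in>hcarrier H. hnorm H (T f) \<le> K * hnorm H f)"

definition op_norm :: "'x hspace \<Rightarrow> 'x operator \<Rightarrow> real" where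
  "op_norm H T = (SUP f\<in>{f \<in> hcarrier H. hnorm H f \<le> 1}. hnorm H (T f))"

definition adjoint_op :: "'x hspace \<Rightarrow> 'x operator \<Rightarrow> 'x operator" where
  "adjoint_op H T = (THE S. bounded_op H S \<and>
     (\<forall>f\<in>hcarrier H. \<forall>g\<in>hcarrier H. hinner H (T f) g = hinner H f (S g)))"

definition positive_op :: "'x hspace \<Rightarrow> 'x operator \<Rightarrow> bool" where
  "positive_op H T \<longleftrightarrow>
     bounded_op H T \<and> (\<forall>f\<in>hcarrier H. hinner H (T f) f \<in> \<real>\<^sub>\<ge>\<^sub>0)"

definition sqrt_op :: "'x hspace \<Rightarrow> 'x operator \<Rightarrow> 'x operator" where
  "sqrt_op H P = (THE S. positive_op H S \<and> S \<circ> S = P)"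

definition abs_op :: "'x hspace \<Rightarrow> 'x operator \<Rightarrow> 'x operator" where
  "abs_op H T = sqrt_op H (adjoint_op H T \<circ> T)"

definition kernel_op :: "'x hspace \<Rightarrow> 'x operator \<Rightarrow> ('x \<Rightarrow> complex) set" where
  "kernel_op H T = {f \<in> hcarrier H. T f = (\<lambda>_. 0)}"

definition partial_isometry :: "'x hspace \<Rightarrow> 'x operator \<Rightarrow> bool" where
  "partial_isometry H U \<longleftrightarrow> bounded_op H U \<and>
     (\<forall>f\<in>hcarrier H. (\<forall>g\<in>kernel_op H U. hinner H f g = 0) \<longrightarrow> hnorm H (U f) = hnorm H f)"

definition polar_part :: "'x hspace \<Rightarrow> 'x operator \<Rightarrow> 'x operator" where
  "polar_part H T = (THE U. partial_isometry H U \<and>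
     kernel_op H U = kernel_op H T \<and> kernel_op H T = kernel_op H (abs_op H T) \<and>
     T = U \<circ> abs_op H T)"

definition aluthge :: "'x hspace \<Rightarrow> 'x operator \<Rightarrow> 'x operator" where
  "aluthge H T = sqrt_op H (abs_op H T) \<circ> polar_part H T \<circ> sqrt_op H (abs_op H T)"

primrec iterated_aluthge :: "'x hspace \<Rightarrow> 'x operator \<Rightarrow> nat \<Rightarrow> 'x operator" where
  "iterated_aluthge H T 0 = T"
| "iterated_aluthge H T (Suc n) = aluthge H (iterated_aluthge H T n)"

definition sot_tendsto :: "'x hspace \<Rightarrow> (nat \<Rightarrow> 'x operator) \<Rightarrow> 'x operator \<Rightarrow> bool" where
  "sot_tendsto H X L \<longleftrightarrow>
     (\<forall>f\<in>hcarrier H. (\<lambda>n. hnorm H (\<lambda>x. X n f x - L f x)) \<longlonglongrightarrow> 0)"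

definition norm_tendsto :: "'x hspace \<Rightarrow> (nat \<Rightarrow> 'x operator) \<Rightarrow> 'x operator \<Rightarrow> bool" where
  "norm_tendsto H X L \<longleftrightarrow> (\<lambda>n. op_norm H (\<lambda>f x. X n f x - L f x)) \<longlonglongrightarrow> 0"

definition taylor_coeff :: "(complex \<Rightarrow> complex) \<Rightarrow> nat \<Rightarrow> complex" where
  "taylor_coeff f n = (deriv ^^ n) f 0 / fact n"

definition bergman_weight :: "real \<Rightarrow> nat \<Rightarrow> real" where
  "bergman_weight \<alpha> n = fact n * Gamma (\<alpha> + 2) / Gamma (real n + \<alpha> + 2)"

text \<open>
  An analytic function on the unit disk is represented by its extension by zero
  to the whole plane.
\<close>

definition bergman :: "real \<Rightarrow> complex hspace" where
  "bergman \<alpha> =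
     \<lparr> hcarrier = {f. f holomorphic_on ball 0 1 \<and> (\<forall>z. z \<notin> ball 0 1 \<longrightarrow> f z = 0) \<and>
         summable (\<lambda>n. bergman_weight \<alpha> n * (cmod (taylor_coeff f n))\<^sup>2)},
       hinner = (\<lambda>f g. \<Sum>n. complex_of_real (bergman_weight \<alpha> n) *
         taylor_coeff f n * cnj (taylor_coeff g n)) \<rparr>"

definition composition_op ::
    "complex hspace \<Rightarrow> (complex \<Rightarrow> complex) \<Rightarrow> complex operator" where
  "composition_op H \<phi> h =
     (if h \<in> hcarrier H then (\<lambda>z. if z \<in> ball 0 1 then h (\<phi> z) else 0) else (\<lambda>_. 0))"

end

theory Submission
  imports Defs
begin

text \<open>
  Put \<open>\<beta> = \<alpha> + 2\<close> and pass to the coordinate \<open>1 / (1 - z)\<close>, which maps the disk onto the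
  half-plane of real part greater than \<open>1/2\<close>. An affine map \<open>u \<mapsto> r u + s\<close> with \<open>r > 0\<close> preserves
  this half-plane exactly when \<open>r + 2 s \<ge> 1\<close>; read on the disk and multiplied by
  \<open>(r + s (1 - z)) powr (- \<beta>)\<close> it gives a weighted composition operator, called
  \<open>wcomp k r s\<close> below (\<open>k\<close> is a scalar factor). The
  composition operator of \<open>a z + (1 - a)\<close> is the member with \<open>r = 1 / a\<close>, \<open>s = 0\<close>, since
  \<open>1 - \<phi> z = a (1 - z)\<close>.

  The family is closed under everything that enters the Aluthge transform. The product of two
  members is the member of the composed affine maps, adjoints belong to the family again, and for
  every member \<open>T\<close> the operator \<open>T\<^sup>* T\<close> is a multiple of a translation \<open>u \<mapsto> u + t\<close> with
  \<open>t = r + 2 s - 1\<close>. The translations form a semigroup of positive contractions, so square roots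
  halve \<open>t\<close>. The polar part is the unitary member with the same \<open>r\<close> and \<open>r + 2 s = 1\<close>, which comes
  from an automorphism of the disk. Hence one Aluthge step keeps \<open>k\<close> and \<open>r\<close> and multiplies \<open>t\<close> by
  \<open>(1 + r) / 2 > 1\<close>. The iterates are therefore a fixed scalar times a fixed unitary times the
  translation by \<open>t n / 2\<close>, where \<open>t n\<close> tends to infinity. Translations far to the right tend to zero
  strongly, but each of them has norm one, since it hardly shrinks the functions \<open>e c\<close> below when \<open>c\<close>
  is large; so the norms stay bounded below, although a norm limit could only be zero.

  The Hilbert space facts come from the functions \<open>e c z = (1 + c (1 - z)) powr (- \<beta>)\<close> for real
  \<open>c > -1/2\<close> (\<open>ekern\<close>). They are multiples of reproducing kernels at real points, span a
  dense subspace (\<open>kernel_induct\<close>), have inner products \<open>(1 + c + d) powr (- \<beta>)\<close>, and are mapped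
  to multiples of each other by the family. In the model in which the half-plane functions are Laplace
  transforms they are the exponentials \<open>exp (- c x)\<close> up to a common factor, translations are multiplications by such
  exponentials, and \<open>r\<close> acts by dilation. Boundedness of the family (\<open>wcomp_norm_le\<close>)
  comes from the symmetry of the translation semigroup \<open>R s\<close> on the span: from
  \<open>\<parallel>R s f\<parallel>\<^sup>2 = \<langle>f, R (2 s) f\<rangle>\<close> a translation that expanded some \<open>f\<close> would make \<open>R (2^k s) f\<close> grow
  without bound, which it does not.

  Square roots and polar parts are given by descriptions, so their uniqueness is needed too:
  \<open>sqrt_unique\<close> holds in any inner product space, and \<open>polar_partI\<close> uses that the
  absolute value has dense range.
\<close>

section \<open>Operators on inner product spaces of functions\<close>

lemma of_real_cmod_power2: "(complex_of_real (cmod z))\<^sup>2 = z * cnj z"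
  by (metis complex_norm_square of_real_power)

text \<open>
  Adjoints, square roots and polar parts are defined by descriptions. The general theory
  supplies their uniqueness; existence will come from explicit operators.
\<close>

locale inner_product_functions =
  fixes H :: "'x hspace"
  assumes zero_mem: "(\<lambda>_. 0) \<in> hcarrier H"
    and add_mem: "\<And>f g. f \<in> hcarrier H \<Longrightarrow> g \<in> hcarrier H \<Longrightarrow> (\<lambda>x. f x + g x) \<in> hcarrier H"
    and scale_mem: "\<And>c f. f \<in> hcarrier H \<Longrightarrow> (\<lambda>x. c * f x) \<in> hcarrier H"
    and inner_add_left: "\<And>f g h. f \<in> hcarrier H \<Longrightarrow> g \<in> hcarrier H \<Longrightarrow> h \<in> hcarrier H \<Longrightarrow>
      hinner H (\<lambda>x. f x + g x) h = hinner H f h + hinner H g h"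
    and inner_scale_left: "\<And>c f h. f \<in> hcarrier H \<Longrightarrow> h \<in> hcarrier H \<Longrightarrow>
      hinner H (\<lambda>x. c * f x) h = c * hinner H f h"
    and inner_commute: "\<And>f g. f \<in> hcarrier H \<Longrightarrow> g \<in> hcarrier H \<Longrightarrow>
      hinner H g f = cnj (hinner H f g)"
    and inner_ge_0: "\<And>f. f \<in> hcarrier H \<Longrightarrow> 0 \<le> Re (hinner H f f)"
    and inner_definite: "\<And>f. f \<in> hcarrier H \<Longrightarrow> hinner H f f = 0 \<Longrightarrow> f = (\<lambda>_. 0)"
begin

lemma diff_mem:
  assumes "f \<in> hcarrier H" "g \<in> hcarrier H"
  shows "(\<lambda>x. f x - g x) \<in> hcarrier H"
  using add_mem[OF assms(1) scale_mem[OF assms(2), of "-1"]] by simp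

lemma inner_diff_left:
  assumes "f \<in> hcarrier H" "g \<in> hcarrier H" "h \<in> hcarrier H"
  shows "hinner H (\<lambda>x. f x - g x) h = hinner H f h - hinner H g h"
  using inner_add_left[OF assms(1) scale_mem[OF assms(2), of "-1"] assms(3)]
    inner_scale_left[OF assms(2,3), of "-1"] by simp

lemma inner_zero_left:
  assumes "h \<in> hcarrier H"
  shows "hinner H (\<lambda>_. 0) h = 0"
  using inner_scale_left[OF zero_mem assms, of 0] by simp

lemma inner_add_right:
  assumes "f \<in> hcarrier H" "g \<in> hcarrier H" "h \<in> hcarrier H"
  shows "hinner H h (\<lambda>x. f x + g x) = hinner H h f + hinner H h g"
  using assms inner_commute[OF add_mem[OF assms(1,2)] assms(3)] inner_commute[OF assms(1,3)]
    inner_commute[OF assms(2,3)] by (simp add: inner_add_left)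

lemma inner_diff_right:
  assumes "f \<in> hcarrier H" "g \<in> hcarrier H" "h \<in> hcarrier H"
  shows "hinner H h (\<lambda>x. f x - g x) = hinner H h f - hinner H h g"
  using assms inner_commute[OF diff_mem[OF assms(1,2)] assms(3)] inner_commute[OF assms(1,3)]
    inner_commute[OF assms(2,3)] by (simp add: inner_diff_left)

lemma inner_scale_right:
  assumes "f \<in> hcarrier H" "h \<in> hcarrier H"
  shows "hinner H h (\<lambda>x. c * f x) = cnj c * hinner H h f"
  using assms inner_commute[OF scale_mem[OF assms(1), of c] assms(2)] inner_commute[OF assms]
  by (simp add: inner_scale_left)

lemma inner_zero_right:
  assumes "h \<in> hcarrier H"
  shows "hinner H h (\<lambda>_. 0) = 0"
  using inner_scale_right[OF zero_mem assms, of 0] by simp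

lemmas inner_simps =
  inner_add_left inner_diff_left inner_scale_left inner_zero_left
  inner_add_right inner_diff_right inner_scale_right inner_zero_right

lemmas mem_simps = zero_mem add_mem scale_mem diff_mem

lemma hnorm_ge_0: "f \<in> hcarrier H \<Longrightarrow> 0 \<le> hnorm H f"
  by (simp add: hnorm_def inner_ge_0)

lemma hnorm_sq: "f \<in> hcarrier H \<Longrightarrow> (hnorm H f)\<^sup>2 = Re (hinner H f f)"
  by (simp add: hnorm_def inner_ge_0)

lemma inner_self: "f \<in> hcarrier H \<Longrightarrow> hinner H f f = complex_of_real ((hnorm H f)\<^sup>2)"
  using inner_commute[of f f] by (simp add: complex_eq_iff hnorm_sq)

lemma hnorm_zero: "hnorm H (\<lambda>_. 0) = 0"
  by (simp add: hnorm_def inner_simps zero_mem)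

lemma hnorm_eq_0: "f \<in> hcarrier H \<Longrightarrow> hnorm H f = 0 \<Longrightarrow> f = (\<lambda>_. 0)"
  by (rule inner_definite) (auto simp: inner_self)

lemma hnorm_diff_eq_0:
  assumes "f \<in> hcarrier H" "g \<in> hcarrier H" "hnorm H (\<lambda>x. f x - g x) = 0"
  shows "f = g"
proof -
  have "(\<lambda>x. f x - g x) = (\<lambda>_. 0)" using assms by (intro hnorm_eq_0 diff_mem)
  thus ?thesis by (auto simp: fun_eq_iff)
qed

lemma hnorm_scale:
  assumes "f \<in> hcarrier H"
  shows "hnorm H (\<lambda>x. c * f x) = cmod c * hnorm H f"
proof -
  have "hinner H (\<lambda>x. c * f x) (\<lambda>x. c * f x) = complex_of_real ((cmod c)\<^sup>2 * (hnorm H f)\<^sup>2)"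
    using assms by (simp add: inner_simps scale_mem inner_self of_real_cmod_power2 algebra_simps)
  thus ?thesis
    using hnorm_ge_0[OF assms] by (simp add: hnorm_def[of H "\<lambda>x. c * f x"] real_sqrt_mult)
qed

lemma Cauchy_Schwarz:
  assumes f: "f \<in> hcarrier H" and g: "g \<in> hcarrier H"
  shows "cmod (hinner H f g) \<le> hnorm H f * hnorm H g"
proof (cases "hnorm H g = 0")
  case True
  hence "g = (\<lambda>_. 0)" by (rule hnorm_eq_0[OF g])
  thus ?thesis using f by (simp add: inner_simps hnorm_zero)
next
  case False
  define N where "N = (hnorm H g)\<^sup>2"
  have N: "N > 0" using False by (simp add: N_def)
  define t where "t = hinner H f g / complex_of_real N"
  have "0 \<le> Re (hinner H (\<lambda>x. f x - t * g x) (\<lambda>x. f x - t * g x))"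
    using f g by (intro inner_ge_0 diff_mem scale_mem)
  also have "hinner H (\<lambda>x. f x - t * g x) (\<lambda>x. f x - t * g x) =
      complex_of_real ((hnorm H f)\<^sup>2) - cnj t * hinner H f g - t * cnj (hinner H f g)
        + t * cnj t * complex_of_real N"
    using f g inner_commute[OF f g]
    by (simp add: inner_simps mem_simps inner_self N_def algebra_simps)
  also have "\<dots> = complex_of_real ((hnorm H f)\<^sup>2 - (cmod (hinner H f g))\<^sup>2 / N)"
    using N by (simp add: t_def of_real_cmod_power2 field_simps)
  finally have "(cmod (hinner H f g))\<^sup>2 \<le> (hnorm H f * hnorm H g)\<^sup>2"
    using N by (simp add: N_def field_simps)
  thus ?thesis using f g by (simp add: hnorm_ge_0 power2_le_iff_abs_le)
qed

lemma hnorm_triangle: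
  assumes f: "f \<in> hcarrier H" and g: "g \<in> hcarrier H"
  shows "hnorm H (\<lambda>x. f x + g x) \<le> hnorm H f + hnorm H g"
proof -
  have "(hnorm H (\<lambda>x. f x + g x))\<^sup>2 = (hnorm H f)\<^sup>2 + (hnorm H g)\<^sup>2 + 2 * Re (hinner H f g)"
    using f g inner_commute[OF f g]
    by (simp add: hnorm_sq inner_simps mem_simps)
  also have "\<dots> \<le> (hnorm H f)\<^sup>2 + (hnorm H g)\<^sup>2 + 2 * (hnorm H f * hnorm H g)"
    using Cauchy_Schwarz[OF f g] complex_Re_le_cmod[of "hinner H f g"] by simp
  also have "\<dots> = (hnorm H f + hnorm H g)\<^sup>2" by (simp add: power2_eq_square algebra_simps)
  finally show ?thesis by (rule power2_le_imp_le) (simp add: hnorm_ge_0 f g)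
qed

lemma hnorm_triangle_via:
  assumes "f \<in> hcarrier H" "g \<in> hcarrier H" "h \<in> hcarrier H"
  shows "hnorm H (\<lambda>x. f x - h x) \<le> hnorm H (\<lambda>x. f x - g x) + hnorm H (\<lambda>x. g x - h x)"
  using hnorm_triangle[OF diff_mem[OF assms(1,2)] diff_mem[OF assms(2,3)]] by simp

lemma hnorm_diff_commute:
  assumes "f \<in> hcarrier H" "g \<in> hcarrier H"
  shows "hnorm H (\<lambda>x. f x - g x) = hnorm H (\<lambda>x. g x - f x)"
  using hnorm_scale[OF diff_mem[OF assms], of "-1"] by simp

lemma hnorm_le_add_diff:
  assumes "f \<in> hcarrier H" "g \<in> hcarrier H"
  shows "hnorm H f \<le> hnorm H g + hnorm H (\<lambda>x. f x - g x)"
  using hnorm_triangle[OF assms(2) diff_mem[OF assms]] by simp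

lemma inner_right_eqI:
  assumes "g \<in> hcarrier H" "g' \<in> hcarrier H"
    and "\<And>f. f \<in> hcarrier H \<Longrightarrow> hinner H f g = hinner H f g'"
  shows "g = g'"
proof (rule hnorm_diff_eq_0[OF assms(1,2)])
  have d: "(\<lambda>x. g x - g' x) \<in> hcarrier H" by (intro diff_mem assms)
  have "hinner H (\<lambda>x. g x - g' x) (\<lambda>x. g x - g' x) = 0"
    using assms(3)[OF d] assms(1,2) d by (simp only: inner_diff_right) simp
  thus "hnorm H (\<lambda>x. g x - g' x) = 0" by (simp add: hnorm_def)
qed

lemma bounded_op_mem: "bounded_op H T \<Longrightarrow> f \<in> hcarrier H \<Longrightarrow> T f \<in> hcarrier H"
  by (simp add: bounded_op_def)

lemma bounded_op_off: "bounded_op H T \<Longrightarrow> f \<notin> hcarrier H \<Longrightarrow> T f = (\<lambda>_. 0)"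
  by (simp add: bounded_op_def)

lemma bounded_op_add:
  "bounded_op H T \<Longrightarrow> f \<in> hcarrier H \<Longrightarrow> g \<in> hcarrier H \<Longrightarrow>
     T (\<lambda>x. f x + g x) = (\<lambda>x. T f x + T g x)"
  by (simp add: bounded_op_def)

lemma bounded_op_scale:
  "bounded_op H T \<Longrightarrow> f \<in> hcarrier H \<Longrightarrow> T (\<lambda>x. c * f x) = (\<lambda>x. c * T f x)"
  by (simp add: bounded_op_def)

lemma bounded_op_diff:
  assumes "bounded_op H T" "f \<in> hcarrier H" "g \<in> hcarrier H"
  shows "T (\<lambda>x. f x - g x) = (\<lambda>x. T f x - T g x)"
  using bounded_op_add[OF assms(1,2) scale_mem[OF assms(3), of "-1"]]
    bounded_op_scale[OF assms(1,3), of "-1"] by simp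

lemma bounded_op_zero: "bounded_op H T \<Longrightarrow> T (\<lambda>_. 0) = (\<lambda>_. 0)"
  using bounded_op_scale[OF _ zero_mem, of T 0] by simp

lemma bounded_op_bound:
  assumes "bounded_op H T"
  obtains K where "K > 0" "\<And>f. f \<in> hcarrier H \<Longrightarrow> hnorm H (T f) \<le> K * hnorm H f"
proof -
  obtain K where K: "\<forall>f\<in>hcarrier H. hnorm H (T f) \<le> K * hnorm H f"
    using assms by (auto simp: bounded_op_def)
  have "hnorm H (T f) \<le> max K 1 * hnorm H f" if "f \<in> hcarrier H" for f
    using K that mult_right_mono[of K "max K 1" "hnorm H f"] hnorm_ge_0[OF that] by force
  thus ?thesis using that[of "max K 1"] by auto
qed

lemma bdd_above_op_norm_diff:
  assumes S: "bounded_op H S" and T: "bounded_op H T"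
  shows "bdd_above ((\<lambda>f. hnorm H (\<lambda>x. S f x - T f x)) ` {f \<in> hcarrier H. hnorm H f \<le> 1})"
proof -
  obtain K where K: "K > 0" "\<And>f. f \<in> hcarrier H \<Longrightarrow> hnorm H (S f) \<le> K * hnorm H f"
    using bounded_op_bound[OF S] by blast
  obtain L where L: "L > 0" "\<And>f. f \<in> hcarrier H \<Longrightarrow> hnorm H (T f) \<le> L * hnorm H f"
    using bounded_op_bound[OF T] by blast
  show ?thesis
  proof (rule bdd_aboveI2)
    fix g assume g: "g \<in> {f \<in> hcarrier H. hnorm H f \<le> 1}"
    note m = bounded_op_mem[OF S, of g] bounded_op_mem[OF T, of g]
    have "hnorm H (\<lambda>x. S g x - T g x) \<le> hnorm H (S g) + hnorm H (T g)"
      using hnorm_triangle_via[of "S g" "\<lambda>_. 0" "T g"] hnorm_diff_commute[of "\<lambda>_. 0" "T g"] m g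
      by (simp add: zero_mem)
    also have "\<dots> \<le> K * hnorm H g + L * hnorm H g" using K(2)[of g] L(2)[of g] g by simp
    also have "\<dots> \<le> K * 1 + L * 1"
      using g K(1) L(1) by (intro add_mono mult_left_mono) auto
    finally show "hnorm H (\<lambda>x. S g x - T g x) \<le> K + L" by simp
  qed
qed

lemma hnorm_le_op_norm_diff:
  assumes "bounded_op H S" "bounded_op H T" "f \<in> hcarrier H" "hnorm H f \<le> 1"
  shows "hnorm H (\<lambda>x. S f x - T f x) \<le> op_norm H (\<lambda>f x. S f x - T f x)"
  unfolding op_norm_def using assms bdd_above_op_norm_diff by (intro cSUP_upper) auto

lemma bounded_op_eqI:
  assumes "bounded_op H S" "bounded_op H T" "\<And>f. f \<in> hcarrier H \<Longrightarrow> S f = T f"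
  shows "S = T"
  using assms bounded_op_off by (metis ext)

lemma adjoint_opI:
  assumes "bounded_op H S"
    and "\<And>f g. f \<in> hcarrier H \<Longrightarrow> g \<in> hcarrier H \<Longrightarrow> hinner H (T f) g = hinner H f (S g)"
  shows "adjoint_op H T = S"
  unfolding adjoint_op_def
proof (rule the_equality)
  show "bounded_op H S \<and>
     (\<forall>f\<in>hcarrier H. \<forall>g\<in>hcarrier H. hinner H (T f) g = hinner H f (S g))"
    using assms by auto
next
  fix S' assume S': "bounded_op H S' \<and>
     (\<forall>f\<in>hcarrier H. \<forall>g\<in>hcarrier H. hinner H (T f) g = hinner H f (S' g))"
  show "S' = S"
  proof (rule bounded_op_eqI)
    fix g assume g: "g \<in> hcarrier H"
    show "S' g = S g"
    proof (rule inner_right_eqI)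
      fix f assume "f \<in> hcarrier H"
      thus "hinner H f (S' g) = hinner H f (S g)" using S' assms(2) g by metis
    qed (use S' assms g bounded_op_mem in auto)
  qed (use S' assms in auto)
qed

text \<open>
  Polarization: a sesquilinear form with vanishing diagonal is zero, and positivity makes the
  diagonal of \<open>\<langle>A f, g\<rangle> - \<langle>f, A g\<rangle>\<close> vanish.
\<close>

lemma positive_op_selfadjoint:
  assumes A: "positive_op H A" and f: "f \<in> hcarrier H" and g: "g \<in> hcarrier H"
  shows "hinner H (A f) g = hinner H f (A g)"
proof -
  have b: "bounded_op H A" using A by (simp add: positive_op_def)
  note [simp] = bounded_op_mem[OF b] bounded_op_add[OF b] bounded_op_scale[OF b] mem_simps inner_simps
  define S where "S f g = hinner H (A f) g - hinner H f (A g)" for f g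
  have diag: "S h h = 0" if h: "h \<in> hcarrier H" for h
  proof -
    have "hinner H (A h) h \<in> \<real>\<^sub>\<ge>\<^sub>0" using A h by (simp add: positive_op_def)
    hence "cnj (hinner H (A h) h) = hinner H (A h) h"
      by (auto simp: complex_nonneg_Reals_iff complex_eq_iff)
    thus ?thesis using inner_commute[of "A h" h] h by (simp add: S_def)
  qed
  have 1: "S f g + S g f = 0"
  proof -
    have "S (\<lambda>x. f x + g x) (\<lambda>x. f x + g x) = S f f + S g g + (S f g + S g f)"
      using f g by (simp add: S_def algebra_simps)
    thus ?thesis using f g by (simp add: diag)
  qed
  have 2: "\<i> * (S g f - S f g) = 0"
  proof -
    have "S (\<lambda>x. f x + \<i> * g x) (\<lambda>x. f x + \<i> * g x) = S f f + S g g + \<i> * (S g f - S f g)"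
      using f g by (simp add: S_def algebra_simps)
    thus ?thesis using f g by (simp add: diag)
  qed
  from 1 2 have "S f g = 0" by simp
  thus ?thesis by (simp add: S_def)
qed

text \<open>
  A vector on which the quadratic form of \<open>A\<close> is small is almost annihilated by \<open>A\<close>. The
  estimate results from evaluating the form at \<open>f - t A f\<close>, where \<open>t\<close> is the inverse of a bound of \<open>A\<close>.
\<close>

lemma positive_op_norm_sq_le:
  assumes A: "positive_op H A"
  obtains K where "K > 0" "\<And>f. f \<in> hcarrier H \<Longrightarrow> (hnorm H (A f))\<^sup>2 \<le> K * Re (hinner H (A f) f)"
proof -
  have b: "bounded_op H A" using A by (simp add: positive_op_def)
  obtain K where K: "K > 0" "\<And>f. f \<in> hcarrier H \<Longrightarrow> hnorm H (A f) \<le> K * hnorm H f"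
    using bounded_op_bound[OF b] by blast
  note [simp] = bounded_op_mem[OF b] bounded_op_diff[OF b] bounded_op_scale[OF b] mem_simps inner_simps
  have "(hnorm H (A f))\<^sup>2 \<le> K * Re (hinner H (A f) f)" if f: "f \<in> hcarrier H" for f
  proof -
    define t where "t = complex_of_real (1 / K)"
    have tc: "cnj t = t" by (simp add: t_def)
    have nonneg: "0 \<le> Re (hinner H (A h) h)" if "h \<in> hcarrier H" for h
      using A that by (auto simp: positive_op_def complex_nonneg_Reals_iff)
    have "0 \<le> Re (hinner H (A (\<lambda>x. f x - t * A f x)) (\<lambda>x. f x - t * A f x))"
      by (rule nonneg) (use f in simp)
    also have "hinner H (A (\<lambda>x. f x - t * A f x)) (\<lambda>x. f x - t * A f x) =
        hinner H (A f) f - 2 * t * hinner H (A f) (A f) + t\<^sup>2 * hinner H (A (A f)) (A f)"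
      using f positive_op_selfadjoint[OF A, of "A f" f] tc
      by (simp add: power2_eq_square algebra_simps)
    also have "Re \<dots> = Re (hinner H (A f) f) - 2 / K * (hnorm H (A f))\<^sup>2
        + 1 / K\<^sup>2 * Re (hinner H (A (A f)) (A f))"
      using f by (simp add: inner_self t_def power2_eq_square)
    also have "Re (hinner H (A (A f)) (A f)) \<le> K * (hnorm H (A f))\<^sup>2"
    proof -
      have "Re (hinner H (A (A f)) (A f)) \<le> hnorm H (A (A f)) * hnorm H (A f)"
        using Cauchy_Schwarz[of "A (A f)" "A f"] complex_Re_le_cmod[of "hinner H (A (A f)) (A f)"] f
        by simp
      also have "\<dots> \<le> K * hnorm H (A f) * hnorm H (A f)"
        using K f by (intro mult_right_mono) (auto simp: hnorm_ge_0)
      finally show ?thesis by (simp add: power2_eq_square)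
    qed
    finally have "0 \<le> Re (hinner H (A f) f) - 1 / K * (hnorm H (A f))\<^sup>2"
      using K by (simp add: power2_eq_square field_simps divide_right_mono)
    thus ?thesis using K by (simp add: field_simps)
  qed
  thus ?thesis using that K by blast
qed

text \<open>
  The difference \<open>D = A - B\<close> satisfies \<open>A D = - D B\<close> and \<open>B D = - D A\<close>, because \<open>A\<^sup>2 = B\<^sup>2\<close>.
  Therefore \<open>\<langle>(A + B) x, D\<^sup>2 x\<rangle> = - \<langle>(A + B) D x, D x\<rangle> \<le> 0\<close>. If \<open>N > 0\<close> is the norm of \<open>D\<close>,
  the unit ball contains \<open>x\<close> with \<open>\<parallel>D x\<parallel>\<close> close to \<open>N\<close>, hence with \<open>D\<^sup>2 x\<close>
  close to \<open>N\<^sup>2 x\<close>, and for such \<open>x\<close> both \<open>\<langle>A x, x\<rangle>\<close>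
  and \<open>\<langle>B x, x\<rangle>\<close> must be small. Then \<open>A x\<close> and \<open>B x\<close> are small, against
  \<open>\<parallel>D x\<parallel>\<close> being close to \<open>N\<close>.
\<close>

lemma sqrt_unique:
  assumes A: "positive_op H A" and B: "positive_op H B" and eq: "A \<circ> A = B \<circ> B"
  shows "A = B"
proof -
  have bA: "bounded_op H A" and bB: "bounded_op H B"
    using A B by (auto simp: positive_op_def)
  have pos: "0 \<le> Re (hinner H (A f) f)" "0 \<le> Re (hinner H (B f) f)" if "f \<in> hcarrier H" for f
    using A B that by (auto simp: positive_op_def complex_nonneg_Reals_iff)
  have AA: "A (A f) = B (B f)" for f using eq by (metis comp_apply)
  note [simp] = bounded_op_mem[OF bA] bounded_op_mem[OF bB] mem_simps
    bounded_op_diff[OF bA] bounded_op_diff[OF bB] bounded_op_scale[OF bA] bounded_op_scale[OF bB]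
  define D where "D f = (\<lambda>x. A f x - B f x)" for f
  have Dmem [simp]: "D f \<in> hcarrier H" if "f \<in> hcarrier H" for f
    using that by (simp add: D_def)
  have Dscale: "D (\<lambda>x. c * f x) = (\<lambda>x. c * D f x)" if "f \<in> hcarrier H" for c f
    using that by (simp add: D_def algebra_simps)
  have Dsym: "hinner H (D f) g = hinner H f (D g)"
    if "f \<in> hcarrier H" "g \<in> hcarrier H" for f g
    using that positive_op_selfadjoint[OF A] positive_op_selfadjoint[OF B]
    by (simp add: D_def inner_simps)
  have anti: "A (D f) = (\<lambda>x. (-1) * D (B f) x)" "B (D f) = (\<lambda>x. (-1) * D (A f) x)"
    if "f \<in> hcarrier H" for f
    using that AA[of f] by (auto simp: D_def fun_eq_iff)
  obtain KA where KA: "KA > 0" "\<And>f. f \<in> hcarrier H \<Longrightarrow> hnorm H (A f) \<le> KA * hnorm H f"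
    using bounded_op_bound[OF bA] by blast
  obtain KB where KB: "KB > 0" "\<And>f. f \<in> hcarrier H \<Longrightarrow> hnorm H (B f) \<le> KB * hnorm H f"
    using bounded_op_bound[OF bB] by blast
  obtain LA where LA: "LA > 0"
    "\<And>f. f \<in> hcarrier H \<Longrightarrow> (hnorm H (A f))\<^sup>2 \<le> LA * Re (hinner H (A f) f)"
    using positive_op_norm_sq_le[OF A] by blast
  obtain LB where LB: "LB > 0"
    "\<And>f. f \<in> hcarrier H \<Longrightarrow> (hnorm H (B f))\<^sup>2 \<le> LB * Re (hinner H (B f) f)"
    using positive_op_norm_sq_le[OF B] by blast
  have Dle: "hnorm H (D f) \<le> hnorm H (A f) + hnorm H (B f)" if "f \<in> hcarrier H" for f
    using that hnorm_triangle_via[of "A f" "\<lambda>_. 0" "B f"] hnorm_diff_commute[of "\<lambda>_. 0" "B f"]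
    by (simp add: D_def)
  define U where "U = {f \<in> hcarrier H. hnorm H f \<le> 1}"
  define N where "N = (SUP f\<in>U. hnorm H (D f))"
  have bdd: "bdd_above ((\<lambda>f. hnorm H (D f)) ` U)"
    unfolding U_def D_def by (rule bdd_above_op_norm_diff[OF bA bB])
  have zU: "(\<lambda>_. 0) \<in> U" by (simp add: U_def hnorm_zero)
  have N_upper: "hnorm H (D f) \<le> N" if "f \<in> U" for f
    unfolding N_def using that bdd by (intro cSUP_upper)
  have N0: "N \<ge> 0" using N_upper[OF zU] hnorm_ge_0[OF Dmem[OF zero_mem]] by simp
  have N_bound: "hnorm H (D f) \<le> N * hnorm H f" if f: "f \<in> hcarrier H" for f
  proof (cases "hnorm H f = 0")
    case True
    hence "f = (\<lambda>_. 0)" by (rule hnorm_eq_0[OF f])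
    thus ?thesis using True Dscale[OF zero_mem, of 0] by (simp add: hnorm_zero)
  next
    case False
    define n where "n = hnorm H f"
    have n: "n > 0" using False hnorm_ge_0[OF f] by (simp add: n_def)
    have "hnorm H (D (\<lambda>x. complex_of_real (1 / n) * f x)) \<le> N"
    proof (rule N_upper)
      have "hnorm H (\<lambda>x. complex_of_real (1 / n) * f x) = 1"
        using n by (simp only: hnorm_scale[OF f]) (simp add: n_def norm_divide)
      thus "(\<lambda>x. complex_of_real (1 / n) * f x) \<in> U" using f by (simp add: U_def del: of_real_divide)
    qed
    hence "1 / n * hnorm H (D f) \<le> N"
      using n by (simp only: Dscale[OF f] hnorm_scale[OF Dmem[OF f]]) (simp add: norm_divide)
    thus ?thesis using n by (simp add: n_def field_simps)
  qed
  have "N = 0"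
  proof (rule ccontr)
    assume "N \<noteq> 0"
    hence N: "N > 0" using N0 by simp
    define C where "C = (KA + KB) * sqrt 2 / N"
    have C: "C > 0" using KA(1) KB(1) N by (simp add: C_def)
    have small: "N\<^sup>2 - e \<le> 2 * ((LA + LB) * (C * sqrt e))" if e: "e > 0" for e
    proof -
      \<comment> \<open>\<open>d\<close> makes \<open>(N - d)\<^sup>2 \<ge> N\<^sup>2 - e\<close>; the minimum with \<open>N\<close> keeps
        the base of the square nonnegative.\<close>
      define d where "d = min (e / (2 * N)) N"
      have d: "d > 0" using e N by (simp add: d_def)
      have "\<exists>f\<in>U. N - d < hnorm H (D f)"
        using less_cSUP_iff[of U "\<lambda>f. hnorm H (D f)" "N - d"] zU bdd d by (auto simp: N_def)
      then obtain x where x: "x \<in> U" "N - d < hnorm H (D x)" by blast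
      have xC [simp]: "x \<in> hcarrier H" and x1: "hnorm H x \<le> 1" using x by (auto simp: U_def)
      have "N\<^sup>2 - e \<le> (N - d)\<^sup>2"
      proof -
        have "2 * N * d \<le> e" using N by (auto simp: d_def min_def field_simps)
        moreover have "0 \<le> d * d" by simp
        ultimately have "N * N - e \<le> N * N - 2 * N * d + d * d" by linarith
        thus ?thesis by (simp add: power2_eq_square algebra_simps)
      qed
      also have "\<dots> \<le> (hnorm H (D x))\<^sup>2"
        using x by (intro power_mono) (auto simp: d_def)
      finally have near: "N\<^sup>2 - e \<le> (hnorm H (D x))\<^sup>2" .
      \<comment> \<open>The defect of \<open>x\<close> as an eigenvector of \<open>D\<^sup>2\<close> for \<open>N\<^sup>2\<close>.\<close>
      define y where "y = (\<lambda>z. D (D x) z - complex_of_real (N\<^sup>2) * x z)"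
      have yC [simp]: "y \<in> hcarrier H" by (simp add: y_def del: of_real_power)
      have y: "hnorm H y \<le> sqrt (2 * e) * N"
      proof -
        have "(hnorm H y)\<^sup>2 = (hnorm H (D (D x)))\<^sup>2 - 2 * N\<^sup>2 * (hnorm H (D x))\<^sup>2 + N^4 * (hnorm H x)\<^sup>2"
          using inner_commute[of "D (D x)" x] Dsym[of "D x" x]
          by (simp add: y_def hnorm_sq inner_simps del: of_real_power)
             (simp add: power2_eq_square power4_eq_xxxx algebra_simps)
        also have "\<dots> \<le> (N * N)\<^sup>2 - 2 * N\<^sup>2 * (N\<^sup>2 - e) + N^4 * 1"
        proof -
          have "hnorm H (D (D x)) \<le> N * hnorm H (D x)" by (rule N_bound) simp
          also have "\<dots> \<le> N * N" using N_upper[OF x(1)] N by (intro mult_left_mono) auto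
          finally have "(hnorm H (D (D x)))\<^sup>2 \<le> (N * N)\<^sup>2"
            by (intro power_mono) (auto simp: hnorm_ge_0)
          moreover have "(hnorm H x)\<^sup>2 \<le> 1" using x1 hnorm_ge_0[of x] by (simp add: power_le_one)
          hence "N^4 * (hnorm H x)\<^sup>2 \<le> N^4 * 1" using N by (intro mult_left_mono) auto
          moreover have "2 * N\<^sup>2 * (N\<^sup>2 - e) \<le> 2 * N\<^sup>2 * (hnorm H (D x))\<^sup>2"
            using near N by (intro mult_left_mono) auto
          ultimately show ?thesis by linarith
        qed
        also have "\<dots> = (sqrt (2 * e) * N)\<^sup>2"
          using e by (simp add: power_mult_distrib power2_eq_square power4_eq_xxxx algebra_simps)
        finally show ?thesis by (rule power2_le_imp_le) (use N e in simp)
      qed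
      have est: "Re (hinner H (A x) x) + Re (hinner H (B x) x) \<le> C * sqrt e"
      proof -
        define s where "s = (\<lambda>z. A x z + B x z)"
        have sC [simp]: "s \<in> hcarrier H" by (simp add: s_def)
        have "Re (hinner H s (D (D x))) \<le> 0"
        proof -
          have "hinner H s (D (D x)) = hinner H (D (A x)) (D x) + hinner H (D (B x)) (D x)"
            using Dsym[of "A x" "D x"] Dsym[of "B x" "D x"] by (simp add: s_def inner_simps)
          also have "D (A x) = (\<lambda>z. (-1) * B (D x) z)" using anti(2)[of x] by (simp add: fun_eq_iff)
          also have "D (B x) = (\<lambda>z. (-1) * A (D x) z)" using anti(1)[of x] by (simp add: fun_eq_iff)
          also have "hinner H (\<lambda>z. (-1) * B (D x) z) (D x) + hinner H (\<lambda>z. (-1) * A (D x) z) (D x)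
              = - (hinner H (B (D x)) (D x) + hinner H (A (D x)) (D x))"
            by (simp only: inner_scale_left Dmem xC bounded_op_mem[OF bA] bounded_op_mem[OF bB])
               (simp add: algebra_simps)
          finally show ?thesis using pos[of "D x"] by simp
        qed
        moreover have "hinner H s (D (D x)) = hinner H s y + complex_of_real (N\<^sup>2) * hinner H s x"
          by (simp add: y_def inner_simps del: of_real_power)
        ultimately have "N\<^sup>2 * Re (hinner H s x) \<le> - Re (hinner H s y)" by simp
        also have "\<dots> \<le> hnorm H s * hnorm H y"
          using Cauchy_Schwarz[of s y] abs_Re_le_cmod[of "hinner H s y"] by simp
        also have "\<dots> \<le> (KA + KB) * (sqrt (2 * e) * N)"
        proof (rule mult_mono[OF _ y])
          have "hnorm H s \<le> KA * hnorm H x + KB * hnorm H x"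
            using hnorm_triangle[of "A x" "B x"] KA(2)[of x] KB(2)[of x] by (simp add: s_def)
          also have "\<dots> \<le> KA * 1 + KB * 1"
            using x1 KA(1) KB(1) by (intro add_mono mult_left_mono) auto
          finally show "hnorm H s \<le> KA + KB" by simp
        qed (use KA KB in \<open>auto simp: hnorm_ge_0\<close>)
        also have "\<dots> = N\<^sup>2 * (C * sqrt e)"
          using N by (simp add: C_def real_sqrt_mult power2_eq_square)
        finally have "Re (hinner H s x) \<le> C * sqrt e"
          using N by simp
        thus ?thesis by (simp add: s_def inner_simps)
      qed
      have "(hnorm H (D x))\<^sup>2 \<le> (hnorm H (A x) + hnorm H (B x))\<^sup>2"
        using Dle[of x] by (intro power_mono) (auto simp: hnorm_ge_0)
      also have "\<dots> \<le> 2 * ((hnorm H (A x))\<^sup>2 + (hnorm H (B x))\<^sup>2)"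
        using sum_squares_bound[of "hnorm H (A x)" "hnorm H (B x)"]
        by (simp add: power2_eq_square algebra_simps)
      also have "\<dots> \<le> 2 * (LA * Re (hinner H (A x) x) + LB * Re (hinner H (B x) x))"
        using LA(2)[of x] LB(2)[of x] by simp
      also have "\<dots> \<le> 2 * ((LA + LB) * (C * sqrt e))"
      proof -
        have "LA * Re (hinner H (A x) x) \<le> LA * (C * sqrt e)"
          using est pos[of x] LA(1) by (intro mult_left_mono) auto
        moreover have "LB * Re (hinner H (B x) x) \<le> LB * (C * sqrt e)"
          using est pos[of x] LB(1) by (intro mult_left_mono) auto
        ultimately show ?thesis by (simp add: algebra_simps)
      qed
      finally show ?thesis using near by linarith
    qed
    have "((\<lambda>e. N\<^sup>2 - e) \<longlongrightarrow> N\<^sup>2 - 0) (at_right 0)" by (intro tendsto_intros)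
    moreover have "((\<lambda>e. 2 * ((LA + LB) * (C * sqrt e))) \<longlongrightarrow> 2 * ((LA + LB) * (C * sqrt 0))) (at_right 0)"
      by (intro tendsto_intros)
    moreover have "eventually (\<lambda>e. N\<^sup>2 - e \<le> 2 * ((LA + LB) * (C * sqrt e))) (at_right 0)"
      using small by (auto simp: eventually_at_right_less intro: eventually_mono[OF eventually_at_right_less])
    ultimately have "N\<^sup>2 - 0 \<le> 2 * ((LA + LB) * (C * sqrt 0))"
      by (intro tendsto_le[OF _ _ , of "at_right 0"]) auto
    thus False using N by simp
  qed
  show ?thesis
  proof (rule bounded_op_eqI[OF bA bB])
    fix f assume f: "f \<in> hcarrier H"
    have "hnorm H (D f) = 0" using N_bound[OF f] \<open>N = 0\<close> hnorm_ge_0[OF Dmem[OF f]] by simp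
    thus "A f = B f" using f by (intro hnorm_diff_eq_0) (auto simp: D_def)
  qed
qed

lemma sqrt_opI:
  assumes "positive_op H S" "S \<circ> S = P"
  shows "sqrt_op H P = S"
  unfolding sqrt_op_def using assms by (intro the_equality) (auto intro: sqrt_unique)

lemma bounded_op_eq_if_eq_on_dense:
  assumes S: "bounded_op H S" and T: "bounded_op H T"
    and dense: "\<And>f e. f \<in> hcarrier H \<Longrightarrow> e > 0 \<Longrightarrow>
      \<exists>g\<in>hcarrier H. hnorm H (\<lambda>x. f x - g x) < e \<and> S g = T g"
  shows "S = T"
proof (rule bounded_op_eqI[OF S T])
  fix f assume f: "f \<in> hcarrier H"
  note [simp] = bounded_op_mem[OF S] bounded_op_mem[OF T] mem_simps f
  obtain K where K: "K > 0" "\<And>f. f \<in> hcarrier H \<Longrightarrow> hnorm H (S f) \<le> K * hnorm H f"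
    using bounded_op_bound[OF S] by blast
  obtain L where L: "L > 0" "\<And>f. f \<in> hcarrier H \<Longrightarrow> hnorm H (T f) \<le> L * hnorm H f"
    using bounded_op_bound[OF T] by blast
  have "hnorm H (\<lambda>x. S f x - T f x) \<le> 0 + e" if e: "e > 0" for e
  proof -
    obtain g where g: "g \<in> hcarrier H" "hnorm H (\<lambda>x. f x - g x) < e / (K + L)" "S g = T g"
      using dense[OF f, of "e / (K + L)"] K(1) L(1) e by auto
    have "hnorm H (\<lambda>x. S f x - T f x)
        \<le> hnorm H (\<lambda>x. S f x - S g x) + hnorm H (\<lambda>x. T f x - T g x)"
      using hnorm_triangle_via[of "S f" "S g" "T f"] hnorm_diff_commute[of "T f" "T g"] g by simp
    also have "\<dots> = hnorm H (S (\<lambda>x. f x - g x)) + hnorm H (T (\<lambda>x. f x - g x))"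
      using g by (simp add: bounded_op_diff[OF S] bounded_op_diff[OF T])
    also have "\<dots> \<le> (K + L) * hnorm H (\<lambda>x. f x - g x)"
      using K(2)[of "\<lambda>x. f x - g x"] L(2)[of "\<lambda>x. f x - g x"] g by (simp add: algebra_simps)
    also have "\<dots> \<le> e" using g K(1) L(1) by (simp add: field_simps)
    finally show ?thesis by simp
  qed
  hence "hnorm H (\<lambda>x. S f x - T f x) \<le> 0" by (rule field_le_epsilon)
  thus "S f = T f" by (intro hnorm_diff_eq_0 antisym hnorm_ge_0) auto
qed

text \<open>
  A partial isometry with \<open>T = U |T|\<close> is prescribed on the range of \<open>|T|\<close>, hence everywhere if that
  range is dense. With \<open>|T|\<close> injective all kernels that have to agree are trivial.
\<close>

lemma polar_partI:
  assumes U: "bounded_op H U" and iso: "\<And>f. f \<in> hcarrier H \<Longrightarrow> hnorm H (U f) = hnorm H f"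
    and T: "T = U \<circ> abs_op H T"
    and A: "bounded_op H (abs_op H T)"
    and dense: "\<And>f e. f \<in> hcarrier H \<Longrightarrow> e > 0 \<Longrightarrow>
      \<exists>g\<in>hcarrier H. hnorm H (\<lambda>x. f x - abs_op H T g x) < e"
    and inj: "\<And>f. f \<in> hcarrier H \<Longrightarrow> abs_op H T f = (\<lambda>_. 0) \<Longrightarrow> f = (\<lambda>_. 0)"
  shows "polar_part H T = U"
proof -
  have injU: "f = (\<lambda>_. 0)" if "f \<in> hcarrier H" "U f = (\<lambda>_. 0)" for f
    using iso[OF that(1)] that hnorm_eq_0 hnorm_zero by metis
  have kA: "kernel_op H (abs_op H T) = {\<lambda>_. 0}"
    using inj bounded_op_zero[OF A] zero_mem by (auto simp: kernel_op_def)
  have kU: "kernel_op H U = {\<lambda>_. 0}"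
    using injU bounded_op_zero[OF U] zero_mem by (auto simp: kernel_op_def)
  have Tf: "T f = U (abs_op H T f)" for f by (metis T comp_apply)
  have kT: "kernel_op H T = {\<lambda>_. 0}"
    using injU bounded_op_zero[OF U] bounded_op_zero[OF A] zero_mem inj bounded_op_mem[OF A]
    by (auto simp: kernel_op_def Tf)
  show ?thesis
    unfolding polar_part_def
  proof (rule the_equality)
    show "partial_isometry H U \<and> kernel_op H U = kernel_op H T \<and>
        kernel_op H T = kernel_op H (abs_op H T) \<and> T = U \<circ> abs_op H T"
      using kA kU kT T U iso by (auto simp: partial_isometry_def)
  next
    fix V assume V: "partial_isometry H V \<and> kernel_op H V = kernel_op H T \<and>
        kernel_op H T = kernel_op H (abs_op H T) \<and> T = V \<circ> abs_op H T"
    have bV: "bounded_op H V" using V by (simp add: partial_isometry_def)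
    show "V = U"
    proof (rule bounded_op_eq_if_eq_on_dense[OF bV U])
      fix f and e :: real assume "f \<in> hcarrier H" "e > 0"
      then obtain g where g: "g \<in> hcarrier H" "hnorm H (\<lambda>x. f x - abs_op H T g x) < e"
        using dense by blast
      have "V (abs_op H T g) = U (abs_op H T g)" using V T by (metis comp_apply)
      thus "\<exists>g\<in>hcarrier H. hnorm H (\<lambda>x. f x - g x) < e \<and> V g = U g"
        using g bounded_op_mem[OF A] by blast
    qed
  qed
qed

text \<open>
  Membership in the norm closure. For a subspace \<open>S\<close> it is preserved by sums, multiples and limits,
  so that it can serve as the predicate in \<open>kernel_induct\<close>.
\<close>

definition approximable :: "('x \<Rightarrow> complex) set \<Rightarrow> ('x \<Rightarrow> complex) \<Rightarrow> bool" where
  "approximable S f \<longleftrightarrow> (\<forall>e>0. \<exists>g\<in>S. hnorm H (\<lambda>x. f x - g x) < e)"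

lemma approximable_self: "f \<in> S \<Longrightarrow> approximable S f"
  by (auto simp: approximable_def hnorm_zero intro!: bexI[of _ f])

lemma approximable_add:
  assumes S: "S \<subseteq> hcarrier H" "\<And>f g. f \<in> S \<Longrightarrow> g \<in> S \<Longrightarrow> (\<lambda>x. f x + g x) \<in> S"
    and f: "f \<in> hcarrier H" "approximable S f" and g: "g \<in> hcarrier H" "approximable S g"
  shows "approximable S (\<lambda>x. f x + g x)"
  unfolding approximable_def
proof (intro allI impI)
  fix e :: real assume "e > 0"
  then obtain f' g' where fg: "f' \<in> S" "hnorm H (\<lambda>x. f x - f' x) < e / 2"
      "g' \<in> S" "hnorm H (\<lambda>x. g x - g' x) < e / 2"
    using f(2) g(2) unfolding approximable_def by (meson half_gt_zero)
  have "hnorm H (\<lambda>x. (f x - f' x) + (g x - g' x)) \<le> hnorm H (\<lambda>x. f x - f' x) + hnorm H (\<lambda>x. g x - g' x)"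
    using f g fg S by (intro hnorm_triangle diff_mem) auto
  also have "(\<lambda>x. (f x - f' x) + (g x - g' x)) = (\<lambda>x. (f x + g x) - (f' x + g' x))" by auto
  finally show "\<exists>h\<in>S. hnorm H (\<lambda>x. f x + g x - h x) < e"
    using fg S(2) by (intro bexI[of _ "\<lambda>x. f' x + g' x"]) auto
qed

lemma approximable_scale:
  assumes S: "S \<subseteq> hcarrier H" "\<And>f. f \<in> S \<Longrightarrow> (\<lambda>x. c * f x) \<in> S"
    and f: "f \<in> hcarrier H" "approximable S f"
  shows "approximable S (\<lambda>x. c * f x)"
  unfolding approximable_def
proof (intro allI impI)
  fix e :: real assume e: "e > 0"
  have c: "cmod c + 1 > 0" by (simp add: add_nonneg_pos)
  then obtain g where g: "g \<in> S" "hnorm H (\<lambda>x. f x - g x) < e / (cmod c + 1)"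
    using f(2) e unfolding approximable_def by (meson divide_pos_pos)
  have gC: "g \<in> hcarrier H" using g S by auto
  have "hnorm H (\<lambda>x. c * (f x - g x)) \<le> (cmod c + 1) * hnorm H (\<lambda>x. f x - g x)"
    unfolding hnorm_scale[OF diff_mem[OF f(1) gC]]
    by (intro mult_right_mono hnorm_ge_0 diff_mem f gC) auto
  also have "\<dots> < e" using g c by (simp add: field_simps)
  finally show "\<exists>h\<in>S. hnorm H (\<lambda>x. c * f x - h x) < e"
    using g S(2) by (intro bexI[of _ "\<lambda>x. c * g x"]) (auto simp: right_diff_distrib)
qed

lemma approximable_limit:
  assumes S: "S \<subseteq> hcarrier H"
    and F: "\<And>k::nat. F k \<in> hcarrier H" "\<And>k. approximable S (F k)" and f: "f \<in> hcarrier H"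
    and lim: "(\<lambda>k. hnorm H (\<lambda>x. F k x - f x)) \<longlonglongrightarrow> 0"
  shows "approximable S f"
  unfolding approximable_def
proof (intro allI impI)
  fix e :: real assume e: "e > 0"
  have "eventually (\<lambda>k. hnorm H (\<lambda>x. F k x - f x) < e / 2) sequentially"
    using e by (intro order_tendstoD(2)[OF lim]) auto
  then obtain k where k: "hnorm H (\<lambda>x. F k x - f x) < e / 2"
    by (auto simp: eventually_sequentially)
  obtain g where g: "g \<in> S" "hnorm H (\<lambda>x. F k x - g x) < e / 2"
    using F(2)[of k] e unfolding approximable_def by (meson half_gt_zero)
  have "hnorm H (\<lambda>x. f x - g x) \<le> hnorm H (\<lambda>x. f x - F k x) + hnorm H (\<lambda>x. F k x - g x)"
    using f F(1) g S by (intro hnorm_triangle_via) auto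
  thus "\<exists>h\<in>S. hnorm H (\<lambda>x. f x - h x) < e"
    using k g hnorm_diff_commute[OF f F(1)[of k]] by (intro bexI[of _ g]) auto
qed

lemma inner_tendsto:
  assumes "h \<in> hcarrier H" "\<And>k::nat. F k \<in> hcarrier H" "f \<in> hcarrier H"
    and lim: "(\<lambda>k. hnorm H (\<lambda>x. F k x - f x)) \<longlonglongrightarrow> 0"
  shows "(\<lambda>k. hinner H h (F k)) \<longlonglongrightarrow> hinner H h f"
proof -
  have "(\<lambda>k. hnorm H h * hnorm H (\<lambda>x. F k x - f x)) \<longlonglongrightarrow> hnorm H h * 0"
    by (intro tendsto_intros lim)
  hence lim': "(\<lambda>k. hnorm H h * hnorm H (\<lambda>x. F k x - f x)) \<longlonglongrightarrow> 0" by simp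
  have "(\<lambda>k. hinner H h (F k) - hinner H h f) \<longlonglongrightarrow> 0"
  proof (rule Lim_null_comparison[OF _ lim'], intro always_eventually allI)
    fix k
    show "norm (hinner H h (F k) - hinner H h f) \<le> hnorm H h * hnorm H (\<lambda>x. F k x - f x)"
      using Cauchy_Schwarz[OF assms(1) diff_mem[OF assms(2,3)], of k] assms
      by (simp add: inner_diff_right)
  qed
  thus ?thesis by (simp add: LIM_zero_iff)
qed

end

section \<open>The weighted Bergman space as a reproducing kernel space\<close>

text \<open>
  All complex powers below have bases in the right half-plane, where arguments of two factors
  add up to less than \<open>pi\<close>, so that no branch of the logarithm is crossed.
\<close>

lemma powr_mult_Re_pos:
  fixes x y s :: complex
  assumes "Re x > 0" "Re y > 0"
  shows "(x * y) powr s = x powr s * y powr s"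
proof -
  have "x \<noteq> 0" "y \<noteq> 0" using assms by auto
  moreover have "\<bar>Im (Ln x)\<bar> < pi / 2" "\<bar>Im (Ln y)\<bar> < pi / 2"
    using assms Re_Ln_pos_lt \<open>x \<noteq> 0\<close> \<open>y \<noteq> 0\<close> by blast+
  ultimately have "Ln (x * y) = Ln x + Ln y"
    by (intro Ln_times_simple) auto
  thus ?thesis using \<open>x \<noteq> 0\<close> \<open>y \<noteq> 0\<close> by (simp add: powr_def exp_add algebra_simps)
qed

lemma taylor_coeff_sums:
  assumes "f holomorphic_on ball 0 1" "cmod z < 1"
  shows "(\<lambda>n. taylor_coeff f n * z ^ n) sums f z"
  using holomorphic_power_series[OF assms(1), of z] assms(2) by (simp add: taylor_coeff_def)

lemma taylor_coeff_eqI: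
  assumes "\<And>z. cmod z < 1 \<Longrightarrow> (\<lambda>n. a n * z ^ n) sums f z"
  shows "taylor_coeff f n = a n"
proof -
  have "f has_fps_expansion Abs_fps a"
  proof (rule has_fps_expansionI)
    have "eventually (\<lambda>u. u \<in> ball 0 1) (nhds (0::complex))"
      by (intro eventually_nhds_in_open) auto
    thus "eventually (\<lambda>u. (\<lambda>n. fps_nth (Abs_fps a) n * u ^ n) sums f u) (nhds 0)"
      by eventually_elim (use assms in auto)
  qed
  from fps_nth_fps_expansion[OF this, of n] show ?thesis by (simp add: taylor_coeff_def)
qed

lemma taylor_coeff_add:
  assumes "f holomorphic_on ball 0 1" "g holomorphic_on ball 0 1"
  shows "taylor_coeff (\<lambda>z. f z + g z) n = taylor_coeff f n + taylor_coeff g n"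
  using higher_deriv_add[OF assms, of 0 n] by (simp add: taylor_coeff_def add_divide_distrib)

lemma taylor_coeff_scale:
  assumes "f holomorphic_on ball 0 1"
  shows "taylor_coeff (\<lambda>z. c * f z) n = c * taylor_coeff f n"
  using higher_deriv_cmult[OF assms, of 0 n c] by (simp add: taylor_coeff_def)

lemma summable_weighted_product:
  fixes a b :: "nat \<Rightarrow> complex" and w :: "nat \<Rightarrow> real"
  assumes w: "\<And>n. w n \<ge> 0"
    and a: "summable (\<lambda>n. w n * (cmod (a n))\<^sup>2)" and b: "summable (\<lambda>n. w n * (cmod (b n))\<^sup>2)"
  shows "summable (\<lambda>n. complex_of_real (w n) * a n * cnj (b n))"
proof (rule summable_comparison_test'[of "\<lambda>n. w n * (cmod (a n))\<^sup>2 + w n * (cmod (b n))\<^sup>2" 0])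
  show "summable (\<lambda>n. w n * (cmod (a n))\<^sup>2 + w n * (cmod (b n))\<^sup>2)"
    using a b by (rule summable_add)
  fix n :: nat
  have "cmod (a n) * cmod (b n) \<le> (cmod (a n))\<^sup>2 + (cmod (b n))\<^sup>2"
    using sum_squares_bound[of "cmod (a n)" "cmod (b n)"]
      mult_nonneg_nonneg[of "cmod (a n)" "cmod (b n)", OF norm_ge_zero norm_ge_zero] by linarith
  hence "w n * (cmod (a n) * cmod (b n)) \<le> w n * ((cmod (a n))\<^sup>2 + (cmod (b n))\<^sup>2)"
    using w by (intro mult_left_mono) auto
  thus "norm (complex_of_real (w n) * a n * cnj (b n)) \<le> w n * (cmod (a n))\<^sup>2 + w n * (cmod (b n))\<^sup>2"
    using w[of n] by (simp add: norm_mult algebra_simps)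
qed

lemma summable_weighted_sum_sq:
  fixes a b :: "nat \<Rightarrow> complex" and w :: "nat \<Rightarrow> real"
  assumes w: "\<And>n. w n \<ge> 0"
    and a: "summable (\<lambda>n. w n * (cmod (a n))\<^sup>2)" and b: "summable (\<lambda>n. w n * (cmod (b n))\<^sup>2)"
  shows "summable (\<lambda>n. w n * (cmod (a n + b n))\<^sup>2)"
proof (rule summable_comparison_test'[of "\<lambda>n. 2 * (w n * (cmod (a n))\<^sup>2 + w n * (cmod (b n))\<^sup>2)" 0])
  show "summable (\<lambda>n. 2 * (w n * (cmod (a n))\<^sup>2 + w n * (cmod (b n))\<^sup>2))"
    by (intro summable_mult summable_add a b)
  fix n :: nat
  have "(cmod (a n + b n))\<^sup>2 \<le> (cmod (a n) + cmod (b n))\<^sup>2"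
    by (intro power_mono norm_triangle_ineq) auto
  also have "\<dots> \<le> 2 * ((cmod (a n))\<^sup>2 + (cmod (b n))\<^sup>2)"
    using sum_squares_bound[of "cmod (a n)" "cmod (b n)"]
    by (simp add: power2_eq_square algebra_simps)
  finally have "w n * (cmod (a n + b n))\<^sup>2 \<le> w n * (2 * ((cmod (a n))\<^sup>2 + (cmod (b n))\<^sup>2))"
    using w by (intro mult_left_mono) auto
  thus "norm (w n * (cmod (a n + b n))\<^sup>2) \<le> 2 * (w n * (cmod (a n))\<^sup>2 + w n * (cmod (b n))\<^sup>2)"
    using w[of n] by (simp add: algebra_simps)
qed

locale bergman_space =
  fixes \<alpha> :: real
  assumes alpha: "\<alpha> > -1"
begin

abbreviation "H \<equiv> bergman \<alpha>"
abbreviation "w \<equiv> bergman_weight \<alpha>"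
definition \<beta> :: real where "\<beta> = \<alpha> + 2"

lemma beta_gt_1: "\<beta> > 1"
  using alpha by (simp add: \<beta>_def)

lemma weight_pos: "w n > 0"
  using alpha by (auto simp: bergman_weight_def intro!: divide_pos_pos mult_pos_pos Gamma_real_pos)

lemma weight_nonneg: "w n \<ge> 0"
  using weight_pos[of n] by simp

lemma mem_iff:
  "f \<in> hcarrier H \<longleftrightarrow> f holomorphic_on ball 0 1 \<and> (\<forall>z. \<not> cmod z < 1 \<longrightarrow> f z = 0) \<and>
     summable (\<lambda>n. w n * (cmod (taylor_coeff f n))\<^sup>2)"
  by (simp add: bergman_def)

lemma mem_holomorphic: "f \<in> hcarrier H \<Longrightarrow> f holomorphic_on ball 0 1"
  by (simp add: mem_iff)

lemma mem_off: "f \<in> hcarrier H \<Longrightarrow> \<not> cmod z < 1 \<Longrightarrow> f z = 0"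
  by (simp add: mem_iff)

lemma mem_summable: "f \<in> hcarrier H \<Longrightarrow> summable (\<lambda>n. w n * (cmod (taylor_coeff f n))\<^sup>2)"
  by (simp add: mem_iff)

lemma inner_eq: "hinner H f g = (\<Sum>n. complex_of_real (w n) * taylor_coeff f n * cnj (taylor_coeff g n))"
  by (simp add: bergman_def)

lemma inner_summable:
  assumes "f \<in> hcarrier H" "g \<in> hcarrier H"
  shows "summable (\<lambda>n. complex_of_real (w n) * taylor_coeff f n * cnj (taylor_coeff g n))"
  using assms by (intro summable_weighted_product weight_nonneg mem_summable)

lemma inner_diag:
  assumes "f \<in> hcarrier H"
  shows "hinner H f f = complex_of_real (\<Sum>n. w n * (cmod (taylor_coeff f n))\<^sup>2)"
proof -
  have "(\<lambda>n. complex_of_real (w n * (cmod (taylor_coeff f n))\<^sup>2)) sums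
      complex_of_real (\<Sum>n. w n * (cmod (taylor_coeff f n))\<^sup>2)"
    by (intro sums_of_real summable_sums mem_summable assms)
  thus ?thesis
    unfolding inner_eq by (simp add: sums_iff of_real_cmod_power2 mult.assoc)
qed

lemma taylor_coeff_ext_0: "f \<in> hcarrier H \<Longrightarrow> (\<And>n. taylor_coeff f n = 0) \<Longrightarrow> f = (\<lambda>_. 0)"
proof
  fix z assume f: "f \<in> hcarrier H" "\<And>n. taylor_coeff f n = 0"
  show "f z = 0"
  proof (cases "cmod z < 1")
    case True
    thus ?thesis using taylor_coeff_sums[OF mem_holomorphic[OF f(1)] True] f(2)
      by (simp add: sums_iff)
  qed (use f mem_off in auto)
qed

sublocale inner_product_functions "bergman \<alpha>"
proof
  have tc0: "taylor_coeff (\<lambda>_. 0) n = 0" for n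
    by (rule taylor_coeff_eqI) auto
  show "(\<lambda>_. 0) \<in> hcarrier H" by (simp add: mem_iff tc0)
next
  fix f g assume fg: "f \<in> hcarrier H" "g \<in> hcarrier H"
  have "summable (\<lambda>n. w n * (cmod (taylor_coeff f n + taylor_coeff g n))\<^sup>2)"
    using fg by (intro summable_weighted_sum_sq weight_nonneg mem_summable)
  thus "(\<lambda>x. f x + g x) \<in> hcarrier H"
    using fg by (auto simp: mem_iff taylor_coeff_add intro: holomorphic_on_add)
  show "hinner H g f = cnj (hinner H f g)"
  proof -
    have "(\<lambda>n. cnj (complex_of_real (w n) * taylor_coeff f n * cnj (taylor_coeff g n))) sums
        cnj (hinner H f g)"
      unfolding inner_eq using inner_summable[OF fg] by (simp only: sums_cnj summable_sums)
    thus ?thesis unfolding inner_eq[of g f] by (simp add: sums_iff mult_ac)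
  qed
  fix h assume h: "h \<in> hcarrier H"
  show "hinner H (\<lambda>x. f x + g x) h = hinner H f h + hinner H g h"
    unfolding inner_eq
    using suminf_add[OF inner_summable[OF fg(1) h] inner_summable[OF fg(2) h]] fg
    by (simp add: taylor_coeff_add mem_holomorphic algebra_simps)
next
  fix c f assume f: "f \<in> hcarrier H"
  have "summable (\<lambda>n. (cmod c)\<^sup>2 * (w n * (cmod (taylor_coeff f n))\<^sup>2))"
    using f by (intro summable_mult mem_summable)
  thus "(\<lambda>x. c * f x) \<in> hcarrier H"
    using f by (auto simp: mem_iff taylor_coeff_scale norm_mult power_mult_distrib mult_ac
        intro!: holomorphic_intros)
  fix h assume h: "h \<in> hcarrier H"
  show "hinner H (\<lambda>x. c * f x) h = c * hinner H f h"
    unfolding inner_eq using suminf_mult[OF inner_summable[OF f h], of c] f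
    by (simp add: taylor_coeff_scale mem_holomorphic mult_ac)
next
  fix f assume f: "f \<in> hcarrier H"
  show "0 \<le> Re (hinner H f f)"
    using f by (simp add: inner_diag suminf_nonneg mem_summable weight_nonneg)
  assume "hinner H f f = 0"
  hence "(\<Sum>n. w n * (cmod (taylor_coeff f n))\<^sup>2) = 0" using f by (simp add: inner_diag)
  hence "w n * (cmod (taylor_coeff f n))\<^sup>2 = 0" for n
    by (subst (asm) suminf_eq_zero_iff) (use f in \<open>auto simp: mem_summable weight_nonneg\<close>)
  hence "taylor_coeff f n = 0" for n using weight_pos[of n] by (metis less_irrefl mult_eq_0_iff norm_eq_zero power_eq_0_iff)
  thus "f = (\<lambda>_. 0)" by (rule taylor_coeff_ext_0[OF f])
qed

lemma hnorm_sq_sum: "f \<in> hcarrier H \<Longrightarrow> (hnorm H f)\<^sup>2 = (\<Sum>n. w n * (cmod (taylor_coeff f n))\<^sup>2)"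
  by (simp add: hnorm_sq inner_diag)

lemma taylor_coeff_diff:
  "f \<in> hcarrier H \<Longrightarrow> g \<in> hcarrier H \<Longrightarrow>
     taylor_coeff (\<lambda>z. f z - g z) n = taylor_coeff f n - taylor_coeff g n"
  using taylor_coeff_add[of f "\<lambda>z. (-1) * g z" n] taylor_coeff_scale[of g "-1" n]
    mem_holomorphic[OF scale_mem[of g "-1"]] by (simp add: mem_holomorphic)

text \<open>
  The reproducing kernel at \<open>v\<close>. Its Taylor coefficients are the conjugate powers of \<open>v\<close>
  divided by the weights, by the binomial series.
\<close>

definition kern :: "complex \<Rightarrow> complex \<Rightarrow> complex" where
  "kern v z = (if cmod z < 1 then (1 - cnj v * z) powr (- of_real \<beta>) else 0)"

text \<open>
  The inverse weights are \<open>\<Gamma> (n + \<beta>) / (n! \<Gamma> \<beta>)\<close>, the coefficients of the binomial series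
  with exponent \<open>- \<beta>\<close>.
\<close>

lemma inverse_weight_sums:
  assumes "cmod x < 1"
  shows "(\<lambda>n. x ^ n / complex_of_real (w n)) sums (1 - x) powr (- of_real \<beta>)"
proof -
  have "((- complex_of_real \<beta>) gchoose n) * (- x) ^ n = x ^ n / complex_of_real (w n)" for n
  proof -
    have "\<beta> \<notin> \<int>\<^sub>\<le>\<^sub>0" using beta_gt_1 by (auto elim!: nonpos_Ints_cases)
    hence "pochhammer \<beta> n = Gamma (\<beta> + real n) / Gamma \<beta>" by (rule pochhammer_Gamma)
    hence "1 / w n = pochhammer \<beta> n / fact n"
      by (simp add: bergman_weight_def \<beta>_def add_ac)
    hence "complex_of_real (1 / w n) = complex_of_real (pochhammer \<beta> n / fact n)" by simp
    hence "1 / complex_of_real (w n) = pochhammer (complex_of_real \<beta>) n / fact n"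
      by (simp add: pochhammer_of_real)
    moreover have "((- complex_of_real \<beta>) gchoose n) * (- x) ^ n
        = ((- 1) ^ n * (- 1) ^ n) * (pochhammer (complex_of_real \<beta>) n / fact n) * x ^ n"
      unfolding gbinomial_pochhammer by (simp add: power_minus[of x])
    moreover have "(- 1) ^ n * (- 1) ^ n = (1::complex)" by (simp flip: power_mult_distrib)
    ultimately have "((- complex_of_real \<beta>) gchoose n) * (- x) ^ n = 1 / complex_of_real (w n) * x ^ n"
      by (simp only: mult_1_left)
    thus ?thesis by simp
  qed
  thus ?thesis using gen_binomial_complex[of "- x" "- complex_of_real \<beta>"] assms by simp
qed

lemma cnj_mult_less_1: "cmod v < 1 \<Longrightarrow> cmod z < 1 \<Longrightarrow> cmod (cnj v * z) < 1"
  using mult_strict_mono'[of "cmod v" 1 "cmod z" 1] by (simp add: norm_mult)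

lemma Re_one_minus_pos: "cmod x < 1 \<Longrightarrow> Re (1 - x) > 0"
  using complex_Re_le_cmod[of x] by simp

lemma taylor_coeff_kern:
  assumes "cmod v < 1"
  shows "taylor_coeff (kern v) n = cnj v ^ n / complex_of_real (w n)"
proof (rule taylor_coeff_eqI)
  fix z :: complex assume "cmod z < 1"
  thus "(\<lambda>n. cnj v ^ n / complex_of_real (w n) * z ^ n) sums kern v z"
    using inverse_weight_sums[OF cnj_mult_less_1[OF assms]]
    by (simp add: kern_def power_mult_distrib)
qed

lemma kern_mem:
  assumes v: "cmod v < 1"
  shows "kern v \<in> hcarrier H"
  unfolding mem_iff
proof (intro conjI)
  have "(\<lambda>z. (1 - cnj v * z) powr (- of_real \<beta>)) holomorphic_on ball 0 1"
  proof (intro holomorphic_intros)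
    fix z :: complex assume "z \<in> ball 0 1"
    hence "Re (1 - cnj v * z) > 0"
      using cnj_mult_less_1[OF v] Re_one_minus_pos by (simp only: mem_ball_0)
    thus "1 - cnj v * z \<notin> \<real>\<^sub>\<le>\<^sub>0" by (simp only: complex_nonpos_Reals_iff) simp
  qed
  thus "kern v holomorphic_on ball 0 1"
    by (rule holomorphic_transform) (auto simp: kern_def)
  show "\<forall>z. \<not> cmod z < 1 \<longrightarrow> kern v z = 0" by (simp add: kern_def)
  have "summable (\<lambda>n. (complex_of_real ((cmod v)\<^sup>2)) ^ n / complex_of_real (w n))"
    using inverse_weight_sums[of "complex_of_real ((cmod v)\<^sup>2)"] v
    by (auto simp: sums_iff norm_power power_less_one_iff abs_square_less_1)
  hence "summable (\<lambda>n. Re ((complex_of_real ((cmod v)\<^sup>2)) ^ n / complex_of_real (w n)))"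
    by (rule summable_Re)
  also have "(\<lambda>n. Re ((complex_of_real ((cmod v)\<^sup>2)) ^ n / complex_of_real (w n)))
      = (\<lambda>n. ((cmod v)\<^sup>2) ^ n / w n)"
    by (simp flip: of_real_power of_real_divide)
  also have "\<dots> = (\<lambda>n. w n * (cmod (taylor_coeff (kern v) n))\<^sup>2)"
    using weight_pos by (auto simp: taylor_coeff_kern v norm_divide norm_power power_divide power2_eq_square
        fun_eq_iff less_imp_neq[symmetric] power_mult_distrib)
  finally show "summable (\<lambda>n. w n * (cmod (taylor_coeff (kern v) n))\<^sup>2)" .
qed

lemma inner_kern:
  assumes f: "f \<in> hcarrier H" and v: "cmod v < 1"
  shows "hinner H f (kern v) = f v"
proof -
  have "(\<lambda>n. complex_of_real (w n) * taylor_coeff f n * cnj (taylor_coeff (kern v) n))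
      = (\<lambda>n. taylor_coeff f n * v ^ n)"
    using weight_pos v by (auto simp: taylor_coeff_kern fun_eq_iff less_imp_neq[symmetric])
  thus ?thesis
    using taylor_coeff_sums[OF mem_holomorphic[OF f] v] by (simp add: inner_eq sums_iff)
qed

lemma norm_eval_le:
  assumes f: "f \<in> hcarrier H" and z: "cmod z < 1"
  shows "cmod (f z) \<le> hnorm H (kern z) * hnorm H f"
  using Cauchy_Schwarz[OF f kern_mem[OF z]] inner_kern[OF f z] by (simp add: mult.commute)

lemma hnorm_kern_sq:
  assumes z: "cmod z < 1"
  shows "(hnorm H (kern z))\<^sup>2 = (1 - (cmod z)\<^sup>2) powr (- \<beta>)"
proof -
  have "hinner H (kern z) (kern z) = (1 - cnj z * z) powr (- of_real \<beta>)"
    using inner_kern[OF kern_mem[OF z] z] z by (simp add: kern_def)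
  also have "1 - cnj z * z = complex_of_real (1 - (cmod z)\<^sup>2)"
    using of_real_cmod_power2[of z] by (simp add: mult.commute)
  also have "complex_of_real (1 - (cmod z)\<^sup>2) powr (- of_real \<beta>) = of_real ((1 - (cmod z)\<^sup>2) powr (- \<beta>))"
    using powr_of_real[of "1 - (cmod z)\<^sup>2" "-\<beta>"] z by (simp add: power_le_one)
  finally show ?thesis using kern_mem[OF z] by (simp add: hnorm_sq)
qed

text \<open>
  The kernel at the real point \<open>c / (1 + c)\<close>, rescaled. In the half-plane coordinate \<open>u = 1 / (1 - z)\<close>
  it is \<open>((u + c) / u) powr (- \<beta>)\<close>, so that affine maps of \<open>u\<close> act on the parameter \<open>c\<close>
  by affine maps.
\<close>

definition ekern :: "real \<Rightarrow> complex \<Rightarrow> complex" where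
  "ekern c z = (if cmod z < 1 then (1 + of_real c * (1 - z)) powr (- of_real \<beta>) else 0)"

lemma ekern_eq_kern:
  assumes c: "c > -1/2"
  defines "v \<equiv> c / (1 + c)"
  shows "\<bar>v\<bar> < 1" and "ekern c = (\<lambda>z. complex_of_real ((1 + c) powr (- \<beta>)) * kern (of_real v) z)"
proof -
  show v: "\<bar>v\<bar> < 1" using c by (auto simp: v_def abs_if field_simps)
  show "ekern c = (\<lambda>z. complex_of_real ((1 + c) powr (- \<beta>)) * kern (of_real v) z)"
  proof
    fix z
    show "ekern c z = complex_of_real ((1 + c) powr (- \<beta>)) * kern (of_real v) z"
    proof (cases "cmod z < 1")
      case True
      have ne: "1 + complex_of_real c \<noteq> 0" using c by (auto simp: complex_eq_iff)
      hence "1 + complex_of_real c * (1 - z) = complex_of_real (1 + c) * (1 - complex_of_real v * z)"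
        by (simp add: v_def field_simps)
      also have "\<dots> powr (- of_real \<beta>) = complex_of_real (1 + c) powr (- of_real \<beta>)
          * (1 - complex_of_real v * z) powr (- of_real \<beta>)"
        using c Re_one_minus_pos[OF cnj_mult_less_1[of "of_real v" z]] v True
        by (intro powr_mult_Re_pos) auto
      also have "complex_of_real (1 + c) powr (- of_real \<beta>) = complex_of_real ((1 + c) powr (- \<beta>))"
        using powr_of_real[of "1 + c" "-\<beta>"] c by simp
      finally show ?thesis using True by (simp add: ekern_def kern_def)
    qed (simp add: ekern_def kern_def)
  qed
qed

lemma ekern_mem: "c > -1/2 \<Longrightarrow> ekern c \<in> hcarrier H"
  using ekern_eq_kern[of c] by (simp add: scale_mem kern_mem del: of_real_divide of_real_add)

lemma inner_ekern:
  assumes f: "f \<in> hcarrier H" and c: "c > -1/2"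
  shows "hinner H f (ekern c) = complex_of_real ((1 + c) powr (- \<beta>)) * f (of_real (c / (1 + c)))"
  using ekern_eq_kern[OF c] f
  by (simp add: inner_scale_right kern_mem inner_kern del: of_real_divide of_real_add)

lemma inner_ekern_ekern:
  assumes c: "c > -1/2" and d: "d > -1/2"
  shows "hinner H (ekern c) (ekern d) = complex_of_real ((1 + c + d) powr (- \<beta>))"
proof -
  have v: "\<bar>d / (1 + d)\<bar> < 1" using ekern_eq_kern(1)[OF d] .
  have p: "1 + c * (1 - d / (1 + d)) = (1 + c + d) / (1 + d)" using d by (simp add: field_simps)
  have "ekern c (of_real x) = complex_of_real (1 + c * (1 - x)) powr (- of_real \<beta>)" if "\<bar>x\<bar> < 1" for x
    using that by (simp add: ekern_def)
  from this[OF v]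
  have "ekern c (of_real (d / (1 + d))) = complex_of_real (1 + c * (1 - d / (1 + d))) powr (- of_real \<beta>)" .
  also have "\<dots> = of_real (((1 + c + d) / (1 + d)) powr (- \<beta>))"
    unfolding p using powr_of_real[of "(1 + c + d) / (1 + d)" "-\<beta>"] c d by simp
  finally have "hinner H (ekern c) (ekern d) =
      of_real ((1 + d) powr (- \<beta>) * ((1 + c + d) / (1 + d)) powr (- \<beta>))"
    using inner_ekern[OF ekern_mem[OF c] d] by simp
  also have "(1 + d) powr (- \<beta>) * ((1 + c + d) / (1 + d)) powr (- \<beta>) = (1 + c + d) powr (- \<beta>)"
  proof -
    have "(1 + d) * ((1 + c + d) / (1 + d)) = 1 + c + d" using d by simp
    thus ?thesis using powr_mult[of "1 + d" "(1 + c + d) / (1 + d)" "-\<beta>"] by simp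
  qed
  finally show ?thesis .
qed

lemma hnorm_ekern:
  assumes c: "c > -1/2"
  shows "hnorm H (ekern c) = (1 + 2 * c) powr (- \<beta> / 2)"
proof -
  have "(1 + c + c) powr (- \<beta>) = ((1 + 2 * c) powr (- \<beta> / 2))\<^sup>2"
    using c by (simp add: power2_eq_square add_ac flip: powr_add)
  thus ?thesis using inner_ekern_ekern[OF c c] by (simp add: hnorm_def)
qed

section \<open>Density of the span of the kernels\<close>

lemma hnorm_le_if_taylor_coeff_le:
  assumes f: "f \<in> hcarrier H" and g: "g \<in> hcarrier H" and M: "M \<ge> 0"
    and le: "\<And>j. cmod (taylor_coeff f j) \<le> M * cmod (taylor_coeff g j)"
  shows "hnorm H f \<le> M * hnorm H g"
proof (rule power2_le_imp_le)
  have "(hnorm H f)\<^sup>2 \<le> (\<Sum>j. M\<^sup>2 * (w j * (cmod (taylor_coeff g j))\<^sup>2))"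
    unfolding hnorm_sq_sum[OF f]
  proof (rule suminf_le)
    fix j
    have "(cmod (taylor_coeff f j))\<^sup>2 \<le> (M * cmod (taylor_coeff g j))\<^sup>2"
      using le by (intro power_mono) auto
    hence "w j * (cmod (taylor_coeff f j))\<^sup>2 \<le> w j * (M * cmod (taylor_coeff g j))\<^sup>2"
      by (intro mult_left_mono weight_nonneg)
    thus "w j * (cmod (taylor_coeff f j))\<^sup>2 \<le> M\<^sup>2 * (w j * (cmod (taylor_coeff g j))\<^sup>2)"
      by (simp add: power_mult_distrib mult_ac)
  qed (intro mem_summable summable_mult f g)+
  also have "\<dots> = (M * hnorm H g)\<^sup>2"
    using g by (simp add: suminf_mult mem_summable hnorm_sq_sum power_mult_distrib)
  finally show "(hnorm H f)\<^sup>2 \<le> (M * hnorm H g)\<^sup>2" .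
  show "0 \<le> M * hnorm H g" using M g by (simp add: hnorm_ge_0)
qed

definition disk_monomial :: "nat \<Rightarrow> complex \<Rightarrow> complex" where
  "disk_monomial n z = (if cmod z < 1 then z ^ n else 0)"

lemma taylor_coeff_disk_monomial: "taylor_coeff (disk_monomial n) j = (if j = n then 1 else 0)"
  by (rule taylor_coeff_eqI) (use powser_sums_if[of n] in \<open>auto simp: disk_monomial_def\<close>)

lemma disk_monomial_mem: "disk_monomial n \<in> hcarrier H"
  unfolding mem_iff
proof (intro conjI)
  have "(\<lambda>z::complex. z ^ n) holomorphic_on ball 0 1" by (intro holomorphic_intros)
  thus "disk_monomial n holomorphic_on ball 0 1"
    by (rule holomorphic_transform) (auto simp: disk_monomial_def)
  show "summable (\<lambda>j. w j * (cmod (taylor_coeff (disk_monomial n) j))\<^sup>2)"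
    by (rule summable_finite[of "{n}"]) (auto simp: taylor_coeff_disk_monomial)
qed (simp add: disk_monomial_def)

lemma lincomb_mem:
  assumes "\<And>j. g j \<in> hcarrier H"
  shows "(\<lambda>z. \<Sum>j<n::nat. c j * g j z) \<in> hcarrier H"
  by (induction n) (simp_all add: zero_mem add_mem scale_mem assms)

lemma taylor_coeff_lincomb:
  assumes "\<And>j. g j \<in> hcarrier H"
  shows "taylor_coeff (\<lambda>z. \<Sum>j<n::nat. c j * g j z) m = (\<Sum>j<n. c j * taylor_coeff (g j) m)"
proof (induction n)
  case 0
  show ?case by simp (rule taylor_coeff_eqI, auto)
next
  case (Suc n)
  thus ?case
    using taylor_coeff_add[OF mem_holomorphic[OF lincomb_mem[of g c n, OF assms]]
        mem_holomorphic[OF scale_mem[OF assms[of n], of "c n"]], of m]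
    by (simp add: taylor_coeff_scale mem_holomorphic assms)
qed

text \<open>
  The functions \<open>ekern c\<close> with \<open>c \<ge> 0\<close> have a dense span. Kernels at points \<open>v\<close> tending to \<open>0\<close> through
  positive reals already suffice: the coefficient of \<open>v ^ n\<close> in the expansion of the kernel at \<open>v\<close> is the
  monomial of degree \<open>n\<close> up to a factor, so once the lower monomials are
  reached, subtracting them and dividing by \<open>v ^ n\<close> gives the next one in the limit.
\<close>

lemma kernel_induct [consumes 1, case_names kernel add scale limit]:
  assumes f: "f \<in> hcarrier H"
    and kernel: "\<And>c. c \<ge> 0 \<Longrightarrow> P (ekern c)"
    and add: "\<And>f g. f \<in> hcarrier H \<Longrightarrow> g \<in> hcarrier H \<Longrightarrow> P f \<Longrightarrow> P g \<Longrightarrow> P (\<lambda>z. f z + g z)"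
    and scale: "\<And>c f. f \<in> hcarrier H \<Longrightarrow> P f \<Longrightarrow> P (\<lambda>z. c * f z)"
    and limit: "\<And>F f. (\<And>k::nat. F k \<in> hcarrier H) \<Longrightarrow> (\<And>k. P (F k)) \<Longrightarrow> f \<in> hcarrier H \<Longrightarrow>
      (\<lambda>k. hnorm H (\<lambda>z. F k z - f z)) \<longlonglongrightarrow> 0 \<Longrightarrow> P f"
  shows "P f"
proof -
  have Pzero: "P (\<lambda>_. 0)" using scale[OF ekern_mem kernel, of 0 0] by simp
  have Pkern: "P (kern (complex_of_real v))" if "0 \<le> v" "v < 1" for v
  proof -
    define c where "c = v / (1 - v)"
    have c: "c \<ge> 0" using that by (simp add: c_def)
    have cv: "c / (1 + c) = v" using that by (simp add: c_def field_simps)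
    define k where "k = complex_of_real ((1 + c) powr (- \<beta>))"
    have k: "k \<noteq> 0" using c by (simp add: k_def)
    have "ekern c = (\<lambda>z. k * kern (of_real v) z)"
      using ekern_eq_kern(2)[of c] c by (simp only: k_def cv)
    hence "kern (complex_of_real v) = (\<lambda>z. inverse k * ekern c z)" using k by (simp add: fun_eq_iff)
    thus ?thesis using scale[OF ekern_mem kernel, of c "inverse k"] c by simp
  qed
  have Plin: "P (\<lambda>z. \<Sum>j<n. c j * disk_monomial j z)" if "\<And>j. j < n \<Longrightarrow> P (disk_monomial j)" for n :: nat and c
    using that by (induction n) (auto intro!: Pzero add lincomb_mem scale scale_mem disk_monomial_mem)
  have Pmono: "P (disk_monomial n)" for n
  proof (induction n rule: less_induct)
    case (less n)
    define v where "v k = 1 / real (k + 2)" for k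
    have v: "0 < v k" "v k \<le> 1 / 2" for k by (auto simp: v_def field_simps)
    have vC: "cmod (complex_of_real (v k)) < 1" for k using v[of k] by simp
    define G where "G k = (\<lambda>z. \<Sum>j<n. (complex_of_real (v k) ^ j / complex_of_real (w j)) * disk_monomial j z)" for k
    \<comment> \<open>The remainder after removing the lower terms has coefficients
        \<open>w n * v ^ (j - n) / w j\<close> for \<open>j \<ge> n\<close>. It is compared with the kernel at \<open>1/2\<close>,
        an element of the space, with a factor \<open>v\<close> to spare.\<close>
    define F where "F k = (\<lambda>z. complex_of_real (w n / v k ^ n) * (kern (of_real (v k)) z - G k z))" for k
    have Gm: "G k \<in> hcarrier H" for k unfolding G_def by (intro lincomb_mem disk_monomial_mem)
    have Fm: "F k \<in> hcarrier H" for k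
      unfolding F_def by (intro scale_mem diff_mem Gm kern_mem vC)
    have coeff: "taylor_coeff (\<lambda>z. F k z - disk_monomial n z) j =
        (if j \<le> n then 0 else complex_of_real (w n * v k ^ (j - n) / w j))" for k j
    proof -
      have "taylor_coeff (G k) j = (\<Sum>i<n. if i = j then complex_of_real (v k) ^ j / complex_of_real (w j) else 0)"
        unfolding G_def taylor_coeff_lincomb[OF disk_monomial_mem]
        by (intro sum.cong) (auto simp: taylor_coeff_disk_monomial)
      also have "\<dots> = (if j < n then complex_of_real (v k) ^ j / complex_of_real (w j) else 0)" by simp
      finally have "taylor_coeff (G k) j = \<dots>" .
      moreover have "taylor_coeff (F k) j
          = complex_of_real (w n / v k ^ n) * (taylor_coeff (kern (of_real (v k))) j - taylor_coeff (G k) j)"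
        unfolding F_def
        by (simp only: taylor_coeff_scale taylor_coeff_diff mem_holomorphic diff_mem Gm kern_mem vC)
      moreover have "complex_of_real (v k) ^ j = complex_of_real (v k) ^ n * complex_of_real (v k) ^ (j - n)" if "j > n"
        using that by (simp flip: power_add)
      ultimately show ?thesis
        using v[of k] weight_pos[of n] weight_pos[of j]
        by (auto simp: taylor_coeff_diff Fm disk_monomial_mem taylor_coeff_kern[OF vC] taylor_coeff_disk_monomial)
    qed
    define M where "M = w n * 2 ^ Suc n * hnorm H (kern (1/2))"
    have bound: "hnorm H (\<lambda>z. F k z - disk_monomial n z) \<le> M * v k" for k
    proof -
      have "hnorm H (\<lambda>z. F k z - disk_monomial n z) \<le> (v k * (w n * 2 ^ Suc n)) * hnorm H (kern (1/2))"
      proof (rule hnorm_le_if_taylor_coeff_le)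
        fix j
        show "cmod (taylor_coeff (\<lambda>z. F k z - disk_monomial n z) j)
            \<le> v k * (w n * 2 ^ Suc n) * cmod (taylor_coeff (kern (1 / 2)) j)"
        proof (cases "j \<le> n")
          case False
          then obtain i where i: "j = Suc (n + i)" using less_iff_Suc_add[of n j] by auto
          have "v k ^ Suc i \<le> v k * (1 / 2) ^ i"
            using v[of k] by (auto simp: power_Suc intro!: mult_left_mono power_mono)
          also have "\<dots> = v k * (2 ^ Suc n * (1 / 2) ^ j)"
            by (simp add: i power_add power_divide)
          finally have "w n * v k ^ Suc i / w j \<le> w n * (v k * (2 ^ Suc n * (1 / 2) ^ j)) / w j"
            using weight_pos by (intro divide_right_mono mult_left_mono) (auto simp: less_imp_le)
          moreover have "j - n = Suc i" by (simp add: i)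
          ultimately show ?thesis
            using False v[of k] weight_pos[of n] weight_pos[of j]
            by (simp add: coeff taylor_coeff_kern norm_mult norm_divide norm_power mult_ac)
        qed (use v[of k] weight_pos[of n] in \<open>simp add: coeff\<close>)
      qed (use v[of k] weight_pos[of n] in \<open>auto intro!: diff_mem Fm disk_monomial_mem kern_mem simp: norm_divide\<close>)
      thus ?thesis by (simp add: M_def mult_ac)
    qed
    show ?case
    proof (rule limit[of F])
      fix k
      have "P (\<lambda>z. kern (of_real (v k)) z + (- 1) * G k z)"
        unfolding G_def using v[of k] less
        by (intro add scale Pkern Plin kern_mem scale_mem lincomb_mem disk_monomial_mem vC) auto
      hence "P (\<lambda>z. kern (of_real (v k)) z - G k z)" by simp
      thus "P (F k)" unfolding F_def by (intro scale diff_mem Gm kern_mem vC)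
    next
      have "v \<longlonglongrightarrow> 0" using LIMSEQ_ignore_initial_segment[OF lim_1_over_n[where 'a=real], of 2]
        by (simp add: v_def[abs_def])
      hence "(\<lambda>k. M * v k) \<longlonglongrightarrow> M * 0" by (intro tendsto_intros)
      hence *: "(\<lambda>k. M * v k) \<longlonglongrightarrow> 0" by simp
      show "(\<lambda>k. hnorm H (\<lambda>z. F k z - disk_monomial n z)) \<longlonglongrightarrow> 0"
        by (rule tendsto_sandwich[OF _ _ tendsto_const *])
           (auto intro!: always_eventually hnorm_ge_0 diff_mem Fm disk_monomial_mem bound)
    qed (use Fm disk_monomial_mem in auto)
  qed
  define S where "S N = (\<lambda>z. \<Sum>n<N. taylor_coeff f n * disk_monomial n z)" for N
  have Sm: "S N \<in> hcarrier H" for N unfolding S_def by (intro lincomb_mem disk_monomial_mem)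
  define a where "a j = w j * (cmod (taylor_coeff f j))\<^sup>2" for j
  have sa: "summable a" unfolding a_def by (rule mem_summable[OF f])
  have tail: "(hnorm H (\<lambda>z. S N z - f z))\<^sup>2 = suminf a - sum a {..<N}" for N
  proof -
    have "taylor_coeff (S N) j = (\<Sum>n<N. if n = j then taylor_coeff f j else 0)" for j
      unfolding S_def taylor_coeff_lincomb[OF disk_monomial_mem]
      by (intro sum.cong) (auto simp: taylor_coeff_disk_monomial)
    hence "w j * (cmod (taylor_coeff (\<lambda>z. S N z - f z) j))\<^sup>2 = a j - (if j \<in> {..<N} then a j else 0)" for j
      by (auto simp: taylor_coeff_diff Sm f a_def)
    moreover have "(\<lambda>j. a j - (if j \<in> {..<N} then a j else 0)) sums (suminf a - sum a {..<N})"
      by (intro sums_diff summable_sums sa sums_If_finite_set) auto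
    ultimately show ?thesis by (simp add: hnorm_sq_sum diff_mem Sm f sums_iff)
  qed
  have "(\<lambda>N. suminf a - sum a {..<N}) \<longlonglongrightarrow> suminf a - suminf a"
    by (intro tendsto_intros summable_LIMSEQ sa)
  hence "(\<lambda>N. sqrt ((hnorm H (\<lambda>z. S N z - f z))\<^sup>2)) \<longlonglongrightarrow> sqrt (suminf a - suminf a)"
    unfolding tail by (rule tendsto_real_sqrt)
  hence "(\<lambda>N. hnorm H (\<lambda>z. S N z - f z)) \<longlonglongrightarrow> 0"
    by (simp add: hnorm_ge_0 diff_mem Sm f)
  moreover have "P (S N)" for N unfolding S_def by (intro Plin Pmono)
  ultimately show "P f" using limit[of S f] Sm f by blast
qed

section \<open>Weighted composition operators\<close>

text \<open>
  The affine map \<open>u \<mapsto> r u + s\<close> in the coordinate \<open>u = 1 / (1 - z)\<close>.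
\<close>

definition disk_affine :: "real \<Rightarrow> real \<Rightarrow> complex \<Rightarrow> complex" where
  "disk_affine r s z = 1 - (1 - z) / (of_real r + of_real s * (1 - z))"

text \<open>
  With \<open>F u = u powr (- \<beta>) * f z\<close> in the coordinate \<open>u = 1 / (1 - z)\<close> this is \<open>k\<close> times the
  substitution \<open>F (r u + s)\<close>; the weight makes adjoints of such operators be of the same kind.
\<close>

definition wcomp :: "real \<Rightarrow> real \<Rightarrow> real \<Rightarrow> complex operator" where
  "wcomp k r s f = (if f \<in> hcarrier H
     then (\<lambda>z. if cmod z < 1
       then of_real k * (of_real r + of_real s * (1 - z)) powr (- of_real \<beta>) * f (disk_affine r s z) else 0)
     else (\<lambda>_. 0))"

lemma denom_Re_pos:
  assumes r: "r > 0" and rs: "r + 2 * s > 0" and z: "cmod z < 1"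
  shows "Re (of_real r + of_real s * (1 - z)) > 0"
proof -
  have x: "0 < Re (1 - z)" "Re (1 - z) < 2"
    using z abs_Re_le_cmod[of z] by auto
  have "r + s * Re (1 - z) > 0"
  proof (cases "s \<ge> 0")
    case True
    thus ?thesis using r x by (intro add_pos_nonneg mult_nonneg_nonneg) auto
  next
    case False
    hence "s * Re (1 - z) \<ge> s * 2" using x by (intro mult_left_mono_neg) auto
    thus ?thesis using rs by simp
  qed
  thus ?thesis by simp
qed

lemma denom_nonzero:
  assumes "r > 0" "r + 2 * s \<ge> 1" "cmod z < 1"
  shows "of_real r + of_real s * (1 - z) \<noteq> (0::complex)"
  using denom_Re_pos[of r s z] assms by force

text \<open>
  The unit disk is \<open>\<bar>p\<bar>\<^sup>2 < 2 Re p\<close> for \<open>p = 1 - z\<close>, that is, \<open>Re (1 / p) > 1/2\<close>. The map \<open>u \<mapsto> r u + s\<close>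
  preserves this half-plane because \<open>r / 2 + s \<ge> 1/2\<close>.
\<close>

lemma cmod_disk_affine_less_1:
  assumes r: "r > 0" and rs: "r + 2 * s \<ge> 1" and z: "cmod z < 1"
  shows "cmod (disk_affine r s z) < 1"
proof -
  define p where "p = 1 - z"
  define q where "q = of_real r + of_real s * p"
  have q0: "q \<noteq> 0" using denom_nonzero[OF assms] by (simp add: q_def p_def)
  have p: "(cmod p)\<^sup>2 < 2 * Re p"
  proof -
    have "(cmod z)\<^sup>2 < 1" using z by (simp add: abs_square_less_1)
    moreover have "(cmod p)\<^sup>2 = 1 - 2 * Re z + (cmod z)\<^sup>2"
      by (simp add: p_def cmod_power2) (simp add: power2_eq_square algebra_simps)
    ultimately show ?thesis by (simp add: p_def)
  qed
  have "(cmod p)\<^sup>2 < 2 * r * Re p + 2 * s * (cmod p)\<^sup>2"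
  proof -
    have "r * (cmod p)\<^sup>2 < r * (2 * Re p)" using p r by (rule mult_strict_left_mono)
    moreover have "(cmod p)\<^sup>2 * 1 \<le> (cmod p)\<^sup>2 * (r + 2 * s)" using rs by (intro mult_left_mono) auto
    ultimately show ?thesis by (simp add: algebra_simps)
  qed
  hence "(cmod (q - p))\<^sup>2 < (cmod q)\<^sup>2"
    by (simp add: cmod_power2 q_def) (simp add: power2_eq_square algebra_simps)
  hence "cmod (q - p) < cmod q" by (rule power2_less_imp_less) simp
  hence "cmod ((q - p) / q) < 1" using q0 by (simp add: norm_divide)
  moreover have "disk_affine r s z = (q - p) / q"
    using q0 by (simp add: disk_affine_def diff_divide_distrib flip: p_def q_def)
  ultimately show ?thesis by simp
qed

lemma wcomp_off: "f \<notin> hcarrier H \<Longrightarrow> wcomp k r s f = (\<lambda>_. 0)"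
  by (simp add: wcomp_def)

lemma wcomp_add:
  "f \<in> hcarrier H \<Longrightarrow> g \<in> hcarrier H \<Longrightarrow> wcomp k r s (\<lambda>z. f z + g z) = (\<lambda>z. wcomp k r s f z + wcomp k r s g z)"
  by (auto simp: wcomp_def add_mem algebra_simps)

lemma wcomp_scale: "f \<in> hcarrier H \<Longrightarrow> wcomp k r s (\<lambda>z. c * f z) = (\<lambda>z. c * wcomp k r s f z)"
  by (auto simp: wcomp_def scale_mem algebra_simps)

lemma wcomp_diff:
  "f \<in> hcarrier H \<Longrightarrow> g \<in> hcarrier H \<Longrightarrow> wcomp k r s (\<lambda>z. f z - g z) = (\<lambda>z. wcomp k r s f z - wcomp k r s g z)"
  by (auto simp: wcomp_def diff_mem algebra_simps)

lemma wcomp_scalar: "wcomp (c * k) r s f = (\<lambda>z. of_real c * wcomp k r s f z)"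
  by (auto simp: wcomp_def)

lemma wcomp_zero: "wcomp k r s (\<lambda>_. 0) = (\<lambda>_. 0)"
  by (auto simp: wcomp_def)

lemma wcomp_1_0: "f \<in> hcarrier H \<Longrightarrow> wcomp 1 1 0 f = f"
  using mem_off by (auto simp: wcomp_def disk_affine_def)

lemma wcomp_comp:
  assumes "r > 0" "r + 2 * s \<ge> 1" "r' > 0" "r' + 2 * s' \<ge> 1" and m: "wcomp k' r' s' f \<in> hcarrier H"
  shows "wcomp k r s (wcomp k' r' s' f) = wcomp (k * k') (r * r') (r' * s + s') f"
proof (cases "f \<in> hcarrier H")
  case f: True
  show ?thesis
  proof
    fix z
    show "wcomp k r s (wcomp k' r' s' f) z = wcomp (k * k') (r * r') (r' * s + s') f z"
    proof (cases "cmod z < 1")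
      case z: True
      define q where "q = of_real r + of_real s * (1 - z)"
      define q' where "q' = of_real r' + of_real s' * (1 - disk_affine r s z)"
      have l: "cmod (disk_affine r s z) < 1" by (rule cmod_disk_affine_less_1) fact+
      have q: "Re q > 0" unfolding q_def by (rule denom_Re_pos) (use assms z in auto)
      have q': "Re q' > 0" unfolding q'_def by (rule denom_Re_pos) (use assms l in auto)
      have q0: "q \<noteq> 0" "q' \<noteq> 0" using q q' by auto
      have lq: "1 - disk_affine r s z = (1 - z) / q" by (simp add: disk_affine_def q_def)
      have qq: "q * q' = of_real (r * r') + of_real (r' * s + s') * (1 - z)"
        using q0 by (simp add: q'_def lq field_simps) (simp add: q_def algebra_simps)
      have "1 - disk_affine r' s' (disk_affine r s z) = (1 - z) / (q * q')"
        unfolding disk_affine_def[of r' s'] q'_def[symmetric] using lq q0 by simp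
      hence ll: "disk_affine r' s' (disk_affine r s z) = disk_affine (r * r') (r' * s + s') z"
        unfolding qq disk_affine_def[of "r * r'"] by (simp add: algebra_simps)
      have "wcomp k r s (wcomp k' r' s' f) z = of_real (k * k') * (q * q') powr (- of_real \<beta>) * f (disk_affine r' s' (disk_affine r s z))"
        using z l f m q' unfolding powr_mult_Re_pos[OF q q']
        by (simp add: wcomp_def flip: q_def q'_def)
      also have "\<dots> = wcomp (k * k') (r * r') (r' * s + s') f z"
        using z f unfolding ll qq by (simp add: wcomp_def)
      finally show ?thesis .
    qed (use m f in \<open>simp add: wcomp_def\<close>)
  qed
qed (simp add: wcomp_off wcomp_zero)

lemma wcomp_ekern:
  assumes r: "r > 0" and rs: "r + 2 * s \<ge> 1" and c: "c > -1/2"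
  shows "wcomp k r s (ekern c) = (\<lambda>z. of_real (k * r powr (- \<beta>)) * ekern ((s + c) / r) z)"
    and "(s + c) / r > -1/2"
proof -
  show c': "(s + c) / r > -1/2" using r rs c by (simp add: field_simps)
  show "wcomp k r s (ekern c) = (\<lambda>z. of_real (k * r powr (- \<beta>)) * ekern ((s + c) / r) z)"
  proof
    fix z
    show "wcomp k r s (ekern c) z = of_real (k * r powr (- \<beta>)) * ekern ((s + c) / r) z"
    proof (cases "cmod z < 1")
      case z: True
      define q where "q = of_real r + of_real s * (1 - z)"
      have l: "cmod (disk_affine r s z) < 1" by (rule cmod_disk_affine_less_1) fact+
      have q: "Re q > 0" unfolding q_def by (rule denom_Re_pos) (use r rs z in auto)
      have q0: "q \<noteq> 0" using q by auto
      have lq: "1 - disk_affine r s z = (1 - z) / q" by (simp add: disk_affine_def q_def)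
      have p1: "Re (of_real 1 + of_real c * (1 - disk_affine r s z)) > 0"
        by (rule denom_Re_pos) (use c l in auto)
      have p2: "Re (of_real 1 + of_real ((s + c) / r) * (1 - z)) > 0"
        by (rule denom_Re_pos) (use c' z in linarith)+
      have "q * (of_real 1 + of_real c * (1 - disk_affine r s z)) = of_real r * (of_real 1 + of_real ((s + c) / r) * (1 - z))"
        using q0 r by (simp add: lq field_simps) (simp add: q_def algebra_simps)
      hence "q powr (- of_real \<beta>) * (of_real 1 + of_real c * (1 - disk_affine r s z)) powr (- of_real \<beta>)
          = of_real r powr (- of_real \<beta>) * (of_real 1 + of_real ((s + c) / r) * (1 - z)) powr (- of_real \<beta>)"
        using powr_mult_Re_pos[OF q p1] powr_mult_Re_pos[OF _ p2, of "of_real r"] r by simp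
      moreover have "of_real r powr (- of_real \<beta>) = complex_of_real (r powr (- \<beta>))"
        using powr_of_real[of r "- \<beta>"] r by simp
      ultimately show ?thesis
        using z l ekern_mem[OF c] by (simp add: wcomp_def ekern_def flip: q_def)
    qed (use ekern_mem[OF c] in \<open>simp add: wcomp_def ekern_def\<close>)
  qed
qed

text \<open>
  Pairing with a kernel evaluates the function, so the action of the adjoint on kernels can be read
  off.
\<close>

lemma inner_wcomp_ekern:
  assumes r: "r > 0" and rs: "r + 2 * s \<ge> 1" and d: "d > -1/2"
    and f: "f \<in> hcarrier H" and m: "wcomp k r s f \<in> hcarrier H"
  shows "hinner H (wcomp k r s f) (ekern d) = of_real k * hinner H f (ekern (r * d + r + s - 1))"
    and "r * d + r + s - 1 > -1/2"
proof -
  define e where "e = r * d + r + s - 1"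
  have "r * d > r * (-1/2)" using r d by (intro mult_strict_left_mono) auto
  thus "r * d + r + s - 1 > -1/2" using rs by simp
  hence e: "e > -1/2" by (simp add: e_def)
  have e1: "1 + e = r * (1 + d) + s" by (simp add: e_def algebra_simps)
  define v where "v = d / (1 + d)"
  have v: "\<bar>v\<bar> < 1" unfolding v_def by (rule ekern_eq_kern(1)[OF d])
  have v1: "1 - v = 1 / (1 + d)" using d by (simp add: v_def field_simps)
  have rv: "r + s * (1 - v) = (1 + e) / (1 + d)" using d by (simp add: v1 e1 field_simps)
  have "disk_affine r s (of_real v) = of_real (1 - (1 - v) / (r + s * (1 - v)))"
    by (simp add: disk_affine_def)
  also have "1 - (1 - v) / (r + s * (1 - v)) = e / (1 + e)"
    unfolding rv unfolding v1 using d e by (simp add: field_simps)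
  finally have lv: "disk_affine r s (of_real v) = of_real (e / (1 + e))" .
  have "complex_of_real r + of_real s * (1 - of_real v) = of_real ((1 + e) / (1 + d))"
    unfolding rv[symmetric] by simp
  hence "(complex_of_real r + of_real s * (1 - of_real v)) powr (- of_real \<beta>) = of_real (((1 + e) / (1 + d)) powr (- \<beta>))"
    using powr_of_real[of "(1 + e) / (1 + d)" "- \<beta>"] d e by simp
  hence "wcomp k r s f (of_real v) = of_real k * of_real (((1 + e) / (1 + d)) powr (- \<beta>)) * f (of_real (e / (1 + e)))"
    using f v lv by (simp add: wcomp_def)
  moreover have "(1 + d) powr (- \<beta>) * ((1 + e) / (1 + d)) powr (- \<beta>) = (1 + e) powr (- \<beta>)"
  proof -
    have "(1 + d) * ((1 + e) / (1 + d)) = 1 + e" using d by simp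
    thus ?thesis using powr_mult[of "1 + d" "(1 + e) / (1 + d)" "-\<beta>"] by simp
  qed
  hence "complex_of_real ((1 + d) powr (- \<beta>)) * of_real (((1 + e) / (1 + d)) powr (- \<beta>)) = of_real ((1 + e) powr (- \<beta>))"
    by (simp only: of_real_mult[symmetric])
  ultimately have "complex_of_real ((1 + d) powr (- \<beta>)) * wcomp k r s f (of_real v)
      = of_real k * (of_real ((1 + e) powr (- \<beta>)) * f (of_real (e / (1 + e))))"
    by (simp only: mult_ac)
  thus "hinner H (wcomp k r s f) (ekern d) = of_real k * hinner H f (ekern (r * d + r + s - 1))"
    unfolding inner_ekern[OF m d] v_def[symmetric] e_def[symmetric] inner_ekern[OF f e] .
qed

text \<open>
  On the span every operator of the family is given explicitly, so that its boundedness can be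
  discussed before it is known to map the whole space into itself.
\<close>

inductive ekern_span :: "(complex \<Rightarrow> complex) \<Rightarrow> bool" where
  ekern: "c > -1/2 \<Longrightarrow> ekern_span (ekern c)"
| add: "ekern_span f \<Longrightarrow> ekern_span g \<Longrightarrow> ekern_span (\<lambda>z. f z + g z)"
| scale: "ekern_span f \<Longrightarrow> ekern_span (\<lambda>z. c * f z)"

lemma ekern_span_mem: "ekern_span f \<Longrightarrow> f \<in> hcarrier H"
  by (induction rule: ekern_span.induct) (auto intro: ekern_mem add_mem scale_mem)

lemma ekern_span_wcomp:
  assumes "ekern_span f" "r > 0" "r + 2 * s \<ge> 1"
  shows "ekern_span (wcomp k r s f)"
  using assms(1)
proof (induction rule: ekern_span.induct)
  case (ekern c)
  show ?case
    unfolding wcomp_ekern(1)[OF assms(2,3) ekern]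
    by (intro ekern_span.scale ekern_span.ekern wcomp_ekern(2)[OF assms(2,3) ekern])
qed (simp_all add: wcomp_add wcomp_scale ekern_span_mem ekern_span.add ekern_span.scale)

text \<open>
  This is the identity \<open>T\<^sup>* T = k\<^sup>2 r powr (- \<beta>) R\<close> with \<open>R\<close> the translation by \<open>r + 2 s - 1\<close>, in weak form.
\<close>

lemma inner_wcomp_wcomp_ekern_span:
  assumes f: "ekern_span f" and g: "ekern_span g" and r: "r > 0" and rs: "r + 2 * s \<ge> 1"
  shows "hinner H (wcomp k r s f) (wcomp k r s g) = of_real (k\<^sup>2 * r powr (- \<beta>)) * hinner H f (wcomp 1 1 (r + 2 * s - 1) g)"
  using g
proof (induction rule: ekern_span.induct)
  case (ekern c)
  define d where "d = (s + c) / r"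
  have d: "d > -1/2" unfolding d_def by (rule wcomp_ekern(2)[OF r rs ekern])
  have Wf: "wcomp k r s f \<in> hcarrier H" using ekern_span_mem ekern_span_wcomp f r rs by blast
  have e: "r * d + r + s - 1 = r + 2 * s - 1 + c" using r by (simp add: d_def)
  have "hinner H (wcomp k r s f) (wcomp k r s (ekern c)) = of_real (k * r powr (- \<beta>)) * hinner H (wcomp k r s f) (ekern d)"
    unfolding wcomp_ekern(1)[OF r rs ekern] d_def[symmetric] using inner_scale_right[OF ekern_mem[OF d] Wf] by simp
  also have "hinner H (wcomp k r s f) (ekern d) = of_real k * hinner H f (ekern (r + 2 * s - 1 + c))"
    unfolding inner_wcomp_ekern(1)[OF r rs d ekern_span_mem[OF f] Wf] e ..
  also have "ekern (r + 2 * s - 1 + c) = wcomp 1 1 (r + 2 * s - 1) (ekern c)"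
    using wcomp_ekern(1)[of 1 "r + 2 * s - 1" c 1] rs ekern by simp
  finally show ?case by (simp add: power2_eq_square mult_ac)
next
  case (add g h)
  have "ekern_span (wcomp k r s f)" "ekern_span (wcomp k r s g)" "ekern_span (wcomp k r s h)"
    "ekern_span (wcomp 1 1 (r + 2 * s - 1) g)" "ekern_span (wcomp 1 1 (r + 2 * s - 1) h)"
    using f add r rs by (auto intro!: ekern_span_wcomp)
  thus ?case using add f by (simp add: wcomp_add ekern_span_mem inner_add_right algebra_simps)
next
  case (scale g c)
  have "ekern_span (wcomp k r s f)" "ekern_span (wcomp k r s g)" "ekern_span (wcomp 1 1 (r + 2 * s - 1) g)"
    using f scale r rs by (auto intro!: ekern_span_wcomp)
  thus ?case using scale f by (simp add: wcomp_scale ekern_span_mem inner_scale_right algebra_simps)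
qed

lemma translation_bounded_ekern_span:
  assumes "ekern_span f"
  shows "\<exists>M. \<forall>s\<ge>0. hnorm H (wcomp 1 1 s f) \<le> M"
  using assms
proof (induction rule: ekern_span.induct)
  case (ekern c)
  show ?case
  proof (intro exI allI impI)
    fix s :: real assume s: "s \<ge> 0"
    have "wcomp 1 1 s (ekern c) = ekern (s + c)" using wcomp_ekern(1)[of 1 s c 1] s ekern by simp
    moreover have "(1 + 2 * (s + c)) powr (- \<beta> / 2) \<le> (1 + 2 * c) powr (- \<beta> / 2)"
      using s ekern beta_gt_1 by (intro powr_mono2') auto
    ultimately show "hnorm H (wcomp 1 1 s (ekern c)) \<le> (1 + 2 * c) powr (- \<beta> / 2)"
      using s ekern by (simp add: hnorm_ekern)
  qed
next
  case (add f g)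
  then obtain M N where M: "\<forall>s\<ge>0. hnorm H (wcomp 1 1 s f) \<le> M" and N: "\<forall>s\<ge>0. hnorm H (wcomp 1 1 s g) \<le> N"
    by blast
  have "hnorm H (wcomp 1 1 s (\<lambda>z. f z + g z)) \<le> M + N" if "s \<ge> 0" for s
  proof -
    have "ekern_span (wcomp 1 1 s f)" "ekern_span (wcomp 1 1 s g)" using add that by (auto intro!: ekern_span_wcomp)
    hence "hnorm H (wcomp 1 1 s (\<lambda>z. f z + g z)) \<le> hnorm H (wcomp 1 1 s f) + hnorm H (wcomp 1 1 s g)"
      using add by (simp add: wcomp_add ekern_span_mem hnorm_triangle)
    thus ?thesis using M N that by (meson add_mono order_trans)
  qed
  thus ?case by blast
next
  case (scale f c)
  then obtain M where M: "\<forall>s\<ge>0. hnorm H (wcomp 1 1 s f) \<le> M" by blast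
  have "hnorm H (wcomp 1 1 s (\<lambda>z. c * f z)) \<le> cmod c * M" if "s \<ge> 0" for s
    using ekern_span_wcomp[OF scale(1), of 1 s 1] that M scale
    by (simp add: wcomp_scale ekern_span_mem hnorm_scale mult_left_mono)
  thus ?case by blast
qed

text \<open>
  By symmetry and Cauchy-Schwarz, \<open>\<parallel>R t f\<parallel>\<^sup>2 \<le> \<parallel>f\<parallel> \<parallel>R (2 t) f\<parallel>\<close>. A ratio \<open>q = \<parallel>R s f\<parallel> / \<parallel>f\<parallel> > 1\<close>
  would thus grow at least like \<open>q ^ (2 ^ k)\<close> along \<open>R (2 ^ k s) f\<close>, while the whole orbit is bounded.
\<close>

lemma translation_contraction_ekern_span:
  assumes f: "ekern_span f" and s: "s \<ge> 0"
  shows "hnorm H (wcomp 1 1 s f) \<le> hnorm H f"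
proof (rule ccontr)
  assume less: "\<not> hnorm H (wcomp 1 1 s f) \<le> hnorm H f"
  have fC: "f \<in> hcarrier H" by (rule ekern_span_mem[OF f])
  have WC: "wcomp 1 1 t f \<in> hcarrier H" if "t \<ge> 0" for t
    using that by (intro ekern_span_mem ekern_span_wcomp f) auto
  have double: "(hnorm H (wcomp 1 1 t f))\<^sup>2 \<le> hnorm H f * hnorm H (wcomp 1 1 (2 * t) f)" if t: "t \<ge> 0" for t
  proof -
    have "complex_of_real ((hnorm H (wcomp 1 1 t f))\<^sup>2) = hinner H f (wcomp 1 1 (2 * t) f)"
      using inner_wcomp_wcomp_ekern_span[OF f f, of 1 t 1] t WC inner_self by simp
    hence "(hnorm H (wcomp 1 1 t f))\<^sup>2 = cmod (hinner H f (wcomp 1 1 (2 * t) f))"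
      by (metis norm_of_real abs_of_nonneg zero_le_power2)
    also have "\<dots> \<le> hnorm H f * hnorm H (wcomp 1 1 (2 * t) f)"
      using t by (intro Cauchy_Schwarz fC WC) auto
    finally show ?thesis .
  qed
  have "hnorm H f \<noteq> 0"
  proof
    assume "hnorm H f = 0"
    thus False using double[OF s] less hnorm_ge_0[OF WC[OF s]] by simp
  qed
  hence n: "hnorm H f > 0" using hnorm_ge_0[OF fC] by simp
  define q where "q = hnorm H (wcomp 1 1 s f) / hnorm H f"
  have q: "q > 1" using less n by (simp add: q_def)
  have pow: "q ^ (2 ^ k) \<le> hnorm H (wcomp 1 1 (2 ^ k * s) f) / hnorm H f" for k
  proof (induction k)
    case (Suc k)
    have "q ^ (2 ^ Suc k) = q ^ (2 ^ k * 2)" by (simp add: mult.commute)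
    also have "\<dots> = (q ^ (2 ^ k))\<^sup>2" by (rule power_mult)
    finally have "q ^ (2 ^ Suc k) = (q ^ (2 ^ k))\<^sup>2" .
    also have "\<dots> \<le> (hnorm H (wcomp 1 1 (2 ^ k * s) f) / hnorm H f)\<^sup>2"
      using Suc q by (intro power_mono) auto
    also have "\<dots> \<le> hnorm H (wcomp 1 1 (2 * (2 ^ k * s)) f) / hnorm H f"
      using double[of "2 ^ k * s"] s n by (simp add: power_divide power2_eq_square field_simps)
    finally show ?case by (simp add: mult.assoc)
  qed (simp add: q_def)
  obtain M where M: "\<forall>t\<ge>0. hnorm H (wcomp 1 1 t f) \<le> M" using translation_bounded_ekern_span[OF f] by blast
  obtain k where k: "M / hnorm H f < q ^ k" using real_arch_pow[OF q] by blast
  have "k < 2 ^ k" by simp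
  hence "q ^ k \<le> q ^ (2 ^ k)" using q by (intro power_increasing) auto
  also have "\<dots> \<le> hnorm H (wcomp 1 1 (2 ^ k * s) f) / hnorm H f" by (rule pow)
  also have "\<dots> \<le> M / hnorm H f" using M s n by (intro divide_right_mono) auto
  finally show False using k by simp
qed

lemma wcomp_ekern_span_norm_le:
  assumes f: "ekern_span f" and r: "r > 0" and rs: "r + 2 * s \<ge> 1"
  shows "hnorm H (wcomp k r s f) \<le> \<bar>k\<bar> * r powr (- \<beta> / 2) * hnorm H f"
proof (rule power2_le_imp_le)
  have fC: "f \<in> hcarrier H" by (rule ekern_span_mem[OF f])
  have WC: "wcomp k r s f \<in> hcarrier H" "wcomp 1 1 (r + 2 * s - 1) f \<in> hcarrier H"
    using f r rs by (auto intro!: ekern_span_mem ekern_span_wcomp)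
  have "complex_of_real ((hnorm H (wcomp k r s f))\<^sup>2) = of_real (k\<^sup>2 * r powr (- \<beta>)) * hinner H f (wcomp 1 1 (r + 2 * s - 1) f)"
    using inner_wcomp_wcomp_ekern_span[OF f f r rs, of k] inner_self[OF WC(1)] by simp
  hence "(hnorm H (wcomp k r s f))\<^sup>2 = cmod (of_real (k\<^sup>2 * r powr (- \<beta>)) * hinner H f (wcomp 1 1 (r + 2 * s - 1) f))"
    by (metis norm_of_real abs_of_nonneg zero_le_power2)
  also have "\<dots> = k\<^sup>2 * r powr (- \<beta>) * cmod (hinner H f (wcomp 1 1 (r + 2 * s - 1) f))"
    by (simp add: norm_mult norm_power)
  also have "\<dots> \<le> k\<^sup>2 * r powr (- \<beta>) * (hnorm H f * hnorm H f)"
  proof (rule mult_left_mono)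
    have "cmod (hinner H f (wcomp 1 1 (r + 2 * s - 1) f)) \<le> hnorm H f * hnorm H (wcomp 1 1 (r + 2 * s - 1) f)"
      by (rule Cauchy_Schwarz[OF fC WC(2)])
    also have "\<dots> \<le> hnorm H f * hnorm H f"
      using rs by (intro mult_left_mono translation_contraction_ekern_span f hnorm_ge_0 fC) auto
    finally show "cmod (hinner H f (wcomp 1 1 (r + 2 * s - 1) f)) \<le> hnorm H f * hnorm H f" .
  qed auto
  also have "r powr (- \<beta>) = (r powr (- \<beta> / 2))\<^sup>2"
    by (simp add: power2_eq_square flip: powr_add)
  finally show "(hnorm H (wcomp k r s f))\<^sup>2 \<le> (\<bar>k\<bar> * r powr (- \<beta> / 2) * hnorm H f)\<^sup>2"
    by (simp add: power_mult_distrib power2_eq_square mult_ac)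
  show "0 \<le> \<bar>k\<bar> * r powr (- \<beta> / 2) * hnorm H f"
    by (intro mult_nonneg_nonneg hnorm_ge_0 fC) auto
qed

lemma ekern_span_dense:
  assumes "f \<in> hcarrier H"
  shows "approximable {g. ekern_span g} f"
  using assms
proof (induction rule: kernel_induct)
  case (kernel c)
  thus ?case by (intro approximable_self) (auto intro: ekern_span.ekern)
qed (auto intro!: approximable_add approximable_scale intro: approximable_limit ekern_span_mem ekern_span.add ekern_span.scale)

lemma wcomp_outside: "\<not> cmod z < 1 \<Longrightarrow> wcomp k r s f z = 0"
  by (simp add: wcomp_def)

lemma wcomp_holomorphic:
  assumes r: "r > 0" and rs: "r + 2 * s \<ge> 1" and f: "f \<in> hcarrier H"
  shows "wcomp k r s f holomorphic_on ball 0 1"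
proof -
  have d: "of_real r + of_real s * (1 - z) \<notin> \<real>\<^sub>\<le>\<^sub>0" if "z \<in> ball 0 1" for z :: complex
  proof -
    have "Re (of_real r + of_real s * (1 - z)) > 0"
      by (rule denom_Re_pos) (use r rs that in auto)
    thus ?thesis by (simp only: complex_nonpos_Reals_iff) simp
  qed
  have n: "of_real r + of_real s * (1 - z) \<noteq> 0" if "z \<in> ball 0 1" for z :: complex
    using denom_nonzero[OF r rs, of z] that by simp
  have "disk_affine r s holomorphic_on ball 0 1"
    unfolding disk_affine_def[abs_def] using n by (intro holomorphic_intros) auto
  hence "(f \<circ> disk_affine r s) holomorphic_on ball 0 1"
    using cmod_disk_affine_less_1[OF r rs]
    by (intro holomorphic_on_compose_gen[OF _ mem_holomorphic[OF f]]) auto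
  hence "(\<lambda>z. of_real k * (of_real r + of_real s * (1 - z)) powr (- of_real \<beta>) * f (disk_affine r s z)) holomorphic_on ball 0 1"
    using d by (intro holomorphic_intros) (auto simp: o_def)
  thus ?thesis by (rule holomorphic_transform) (use f in \<open>auto simp: wcomp_def\<close>)
qed

text \<open>
  Cauchy's inequality on the circle of radius \<open>1/2\<close>, whose image under the affine map stays in a
  compact part of the disk, where point evaluations are uniformly bounded.
\<close>

lemma wcomp_taylor_coeff_bounded:
  assumes r: "r > 0" and rs: "r + 2 * s \<ge> 1"
  obtains B where "\<And>f. f \<in> hcarrier H \<Longrightarrow> cmod (taylor_coeff (wcomp k r s f) n) \<le> B * hnorm H f"
proof -
  define \<phi> where "\<phi> z = cmod (of_real r + of_real s * (1 - z)) powr (- \<beta>) * (1 - (cmod (disk_affine r s z))\<^sup>2) powr (- \<beta> / 2)" for z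
  have n: "of_real r + of_real s * (1 - z) \<noteq> 0" if "z \<in> cball 0 (1/2)" for z :: complex
    using denom_nonzero[OF r rs, of z] that by simp
  have "(cmod (disk_affine r s z))\<^sup>2 \<noteq> 1" if "z \<in> cball 0 (1/2)" for z
    using cmod_disk_affine_less_1[OF r rs, of z] that abs_square_less_1[of "cmod (disk_affine r s z)"] by simp
  hence "continuous_on (cball 0 (1/2)) \<phi>"
    unfolding \<phi>_def using n by (intro continuous_intros) (auto simp: disk_affine_def intro!: continuous_intros)
  hence "compact (\<phi> ` cball 0 (1/2))" by (rule compact_continuous_image) simp
  then obtain B where B: "\<And>z. z \<in> cball 0 (1/2) \<Longrightarrow> \<bar>\<phi> z\<bar> \<le> B"
    using compact_imp_bounded bounded_real by (metis imageI)
  have "cmod (taylor_coeff (wcomp k r s f) n) \<le> (\<bar>k\<bar> * B * 2 ^ n) * hnorm H f" if f: "f \<in> hcarrier H" for f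
  proof -
    have hol: "wcomp k r s f holomorphic_on ball 0 1" by (rule wcomp_holomorphic[OF r rs f])
    have "cmod ((deriv ^^ n) (wcomp k r s f) 0) \<le> fact n * (\<bar>k\<bar> * B * hnorm H f) / (1/2) ^ n"
    proof (rule Cauchy_inequality)
      show "wcomp k r s f holomorphic_on ball 0 (1/2)"
        using hol by (rule holomorphic_on_subset) auto
      show "continuous_on (cball 0 (1/2)) (wcomp k r s f)"
        using holomorphic_on_imp_continuous_on[OF hol] by (rule continuous_on_subset) auto
      fix z :: complex assume "norm (0 - z) = 1/2"
      hence z: "cmod z < 1" "z \<in> cball 0 (1/2)" by auto
      have l: "cmod (disk_affine r s z) < 1" by (rule cmod_disk_affine_less_1[OF r rs z(1)])
      have "(1 - (cmod (disk_affine r s z))\<^sup>2) powr (- \<beta>) = ((1 - (cmod (disk_affine r s z))\<^sup>2) powr (- \<beta> / 2))\<^sup>2"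
        by (simp add: power2_eq_square flip: powr_add)
      hence "hnorm H (kern (disk_affine r s z)) = (1 - (cmod (disk_affine r s z))\<^sup>2) powr (- \<beta> / 2)"
        using hnorm_kern_sq[OF l] hnorm_ge_0[OF kern_mem[OF l]] by (metis power2_eq_imp_eq powr_ge_zero)
      hence fl: "cmod (f (disk_affine r s z)) \<le> (1 - (cmod (disk_affine r s z))\<^sup>2) powr (- \<beta> / 2) * hnorm H f"
        using norm_eval_le[OF f l] by simp
      have "cmod (wcomp k r s f z) = \<bar>k\<bar> * cmod (of_real r + of_real s * (1 - z)) powr (- \<beta>) * cmod (f (disk_affine r s z))"
        using z f by (simp add: wcomp_def norm_mult norm_powr_real_powr')
      also have "\<dots> \<le> \<bar>k\<bar> * cmod (of_real r + of_real s * (1 - z)) powr (- \<beta>) *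
          ((1 - (cmod (disk_affine r s z))\<^sup>2) powr (- \<beta> / 2) * hnorm H f)"
        using fl by (intro mult_left_mono) auto
      also have "\<dots> = \<bar>k\<bar> * \<phi> z * hnorm H f" by (simp add: \<phi>_def)
      also have "\<dots> \<le> \<bar>k\<bar> * B * hnorm H f"
        using B[OF z(2)] f by (intro mult_right_mono mult_left_mono) (auto simp: hnorm_ge_0)
      finally show "cmod (wcomp k r s f z) \<le> \<bar>k\<bar> * B * hnorm H f" .
    qed simp
    thus ?thesis by (simp add: taylor_coeff_def norm_divide field_simps)
  qed
  thus ?thesis using that by blast
qed

text \<open>
  Passage from the span to the whole space. Each Taylor coefficient of the image depends
  continuously on \<open>f\<close>, so every partial sum of the norm series inherits the bound from approximants.
\<close>

lemma
  assumes r: "r > 0" and rs: "r + 2 * s \<ge> 1" and f: "f \<in> hcarrier H"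
  shows wcomp_mem: "wcomp k r s f \<in> hcarrier H"
    and wcomp_norm_le: "hnorm H (wcomp k r s f) \<le> \<bar>k\<bar> * r powr (- \<beta> / 2) * hnorm H f"
proof -
  define M where "M = \<bar>k\<bar> * r powr (- \<beta> / 2)"
  have "\<exists>g. ekern_span g \<and> hnorm H (\<lambda>z. f z - g z) < inverse (real (Suc j))" for j
    using ekern_span_dense[OF f] unfolding approximable_def
    by (metis inverse_positive_iff_positive mem_Collect_eq of_nat_0_less_iff zero_less_Suc)
  then obtain F where F: "\<And>j. ekern_span (F j)" "\<And>j. hnorm H (\<lambda>z. f z - F j z) < inverse (real (Suc j))"
    by metis
  note FC = ekern_span_mem[OF F(1)]
  have lim: "(\<lambda>j. hnorm H (\<lambda>z. f z - F j z)) \<longlonglongrightarrow> 0"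
    by (rule tendsto_sandwich[OF _ _ tendsto_const LIMSEQ_inverse_real_of_nat])
       (intro always_eventually allI hnorm_ge_0 diff_mem f FC less_imp_le[OF F(2)])+
  have WF: "wcomp k r s (F j) \<in> hcarrier H" for j by (intro ekern_span_mem ekern_span_wcomp F r rs)
  define a where "a n = w n * (cmod (taylor_coeff (wcomp k r s f) n))\<^sup>2" for n
  have tcdiff: "taylor_coeff (wcomp k r s f) n - taylor_coeff (wcomp k r s (F j)) n
      = taylor_coeff (wcomp k r s (\<lambda>z. f z - F j z)) n" for n j
    using taylor_coeff_add[OF wcomp_holomorphic[OF r rs f, of k]
        wcomp_holomorphic[OF r rs scale_mem[OF FC, of "-1"], of k]]
      taylor_coeff_scale[OF wcomp_holomorphic[OF r rs FC, of k], where c="-1"]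
      wcomp_diff[OF f FC] wcomp_scale[OF FC, where c="-1"]
    by simp
  have tc: "(\<lambda>j. taylor_coeff (wcomp k r s (F j)) n) \<longlonglongrightarrow> taylor_coeff (wcomp k r s f) n" for n
  proof -
    obtain B where B: "\<And>f. f \<in> hcarrier H \<Longrightarrow> cmod (taylor_coeff (wcomp k r s f) n) \<le> B * hnorm H f"
      using wcomp_taylor_coeff_bounded[OF r rs, where k=k and n=n] by blast
    have "(\<lambda>j. B * hnorm H (\<lambda>z. f z - F j z)) \<longlonglongrightarrow> B * 0" by (intro tendsto_intros lim)
    hence B0: "(\<lambda>j. B * hnorm H (\<lambda>z. f z - F j z)) \<longlonglongrightarrow> 0" by simp
    have "(\<lambda>j. taylor_coeff (wcomp k r s f) n - taylor_coeff (wcomp k r s (F j)) n) \<longlonglongrightarrow> 0"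
      unfolding tcdiff by (rule Lim_null_comparison[OF _ B0]) (auto intro!: always_eventually B diff_mem f FC)
    from tendsto_diff[OF tendsto_const[of "taylor_coeff (wcomp k r s f) n"] this] show ?thesis by simp
  qed
  have partial: "(\<Sum>n<N. a n) \<le> (M * hnorm H f)\<^sup>2" for N
  proof (rule tendsto_le[OF sequentially_bot])
    show "(\<lambda>j. \<Sum>n<N. w n * (cmod (taylor_coeff (wcomp k r s (F j)) n))\<^sup>2) \<longlonglongrightarrow> (\<Sum>n<N. a n)"
      unfolding a_def by (intro tendsto_intros tc)
    have "(\<lambda>j. (M * (hnorm H f + hnorm H (\<lambda>z. f z - F j z)))\<^sup>2) \<longlonglongrightarrow> (M * (hnorm H f + 0))\<^sup>2"
      by (intro tendsto_intros lim)
    thus "(\<lambda>j. (M * (hnorm H f + hnorm H (\<lambda>z. f z - F j z)))\<^sup>2) \<longlonglongrightarrow> (M * hnorm H f)\<^sup>2" by simp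
    show "\<forall>\<^sub>F j in sequentially. (\<Sum>n<N. w n * (cmod (taylor_coeff (wcomp k r s (F j)) n))\<^sup>2)
        \<le> (M * (hnorm H f + hnorm H (\<lambda>z. f z - F j z)))\<^sup>2"
    proof (intro always_eventually allI)
      fix j
      have "(\<Sum>n<N. w n * (cmod (taylor_coeff (wcomp k r s (F j)) n))\<^sup>2) \<le> (hnorm H (wcomp k r s (F j)))\<^sup>2"
        unfolding hnorm_sq_sum[OF WF]
        by (intro sum_le_suminf mem_summable WF) (auto simp: weight_nonneg)
      also have "\<dots> \<le> (M * (hnorm H f + hnorm H (\<lambda>z. f z - F j z)))\<^sup>2"
      proof (rule power_mono)
        have "hnorm H (wcomp k r s (F j)) \<le> M * hnorm H (F j)"
          unfolding M_def by (rule wcomp_ekern_span_norm_le[OF F(1) r rs])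
        also have "\<dots> \<le> M * (hnorm H f + hnorm H (\<lambda>z. f z - F j z))"
          using hnorm_le_add_diff[OF FC f, of j] hnorm_diff_commute[OF f FC, of j]
          by (intro mult_left_mono) (auto simp: M_def)
        finally show "hnorm H (wcomp k r s (F j)) \<le> M * (hnorm H f + hnorm H (\<lambda>z. f z - F j z))" .
      qed (intro hnorm_ge_0 WF)
      finally show "(\<Sum>n<N. w n * (cmod (taylor_coeff (wcomp k r s (F j)) n))\<^sup>2)
        \<le> (M * (hnorm H f + hnorm H (\<lambda>z. f z - F j z)))\<^sup>2" .
    qed
  qed
  have nn: "a n \<ge> 0" for n by (simp add: a_def weight_nonneg)
  have sa: "summable a"
    using partial nn by (intro summableI_nonneg_bounded)
  show mem: "wcomp k r s f \<in> hcarrier H"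
    unfolding mem_iff using wcomp_holomorphic[OF r rs f] sa
    by (simp add: a_def[abs_def] wcomp_outside)
  have "(hnorm H (wcomp k r s f))\<^sup>2 \<le> (M * hnorm H f)\<^sup>2"
    unfolding hnorm_sq_sum[OF mem] a_def[symmetric] by (intro suminf_le_const sa partial)
  thus "hnorm H (wcomp k r s f) \<le> \<bar>k\<bar> * r powr (- \<beta> / 2) * hnorm H f"
    unfolding M_def by (rule power2_le_imp_le) (simp add: hnorm_ge_0 f)
qed

lemma bounded_op_wcomp:
  assumes "r > 0" "r + 2 * s \<ge> 1"
  shows "bounded_op H (wcomp k r s)"
  unfolding bounded_op_def
proof (intro conjI ballI allI impI exI)
  show "hnorm H (wcomp k r s f) \<le> \<bar>k\<bar> * r powr (- \<beta> / 2) * hnorm H f" if "f \<in> hcarrier H" for f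
    by (rule wcomp_norm_le[OF assms that])
qed (auto simp: wcomp_mem[OF assms] wcomp_off wcomp_add wcomp_scale)

lemma wcomp_tendsto:
  assumes "r > 0" "r + 2 * s \<ge> 1" and F: "\<And>j::nat. F j \<in> hcarrier H" and f: "f \<in> hcarrier H"
    and lim: "(\<lambda>j. hnorm H (\<lambda>z. F j z - f z)) \<longlonglongrightarrow> 0"
  shows "(\<lambda>j. hnorm H (\<lambda>z. wcomp k r s (F j) z - wcomp k r s f z)) \<longlonglongrightarrow> 0"
proof -
  have "(\<lambda>j. \<bar>k\<bar> * r powr (- \<beta> / 2) * hnorm H (\<lambda>z. F j z - f z)) \<longlonglongrightarrow> \<bar>k\<bar> * r powr (- \<beta> / 2) * 0"
    by (intro tendsto_intros lim)
  hence lim': "(\<lambda>j. \<bar>k\<bar> * r powr (- \<beta> / 2) * hnorm H (\<lambda>z. F j z - f z)) \<longlonglongrightarrow> 0" by simp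
  show ?thesis
  proof (rule tendsto_sandwich[OF _ _ tendsto_const lim'])
    show "\<forall>\<^sub>F j in sequentially. 0 \<le> hnorm H (\<lambda>z. wcomp k r s (F j) z - wcomp k r s f z)"
      by (intro always_eventually allI hnorm_ge_0 diff_mem wcomp_mem assms)
    show "\<forall>\<^sub>F j in sequentially. hnorm H (\<lambda>z. wcomp k r s (F j) z - wcomp k r s f z)
        \<le> \<bar>k\<bar> * r powr (- \<beta> / 2) * hnorm H (\<lambda>z. F j z - f z)"
      using wcomp_norm_le[OF assms(1,2) diff_mem[OF F f], of k] by (simp add: wcomp_diff F f)
  qed
qed

text \<open>
  Both sides are continuous in \<open>g\<close>, and for kernels the identity is \<open>inner_wcomp_ekern\<close>. The adjoint
  belongs to the map \<open>u \<mapsto> (u - 1 + s) / r + 1\<close>.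
\<close>

lemma inner_wcomp:
  assumes r: "r > 0" and rs: "r + 2 * s \<ge> 1" and f: "f \<in> hcarrier H" and g: "g \<in> hcarrier H"
  shows "hinner H (wcomp k r s f) g = hinner H f (wcomp (k * r powr (- \<beta>)) (1 / r) (1 + (s - 1) / r) g)"
    and "1 / r + 2 * (1 + (s - 1) / r) \<ge> 1"
proof -
  define s' where "s' = 1 + (s - 1) / r"
  have r': "1 / r > 0" using r by simp
  have "1 / r + 2 * s' = (r + 2 * s - 1) / r + 1" using r by (simp add: s'_def field_simps)
  hence rs': "1 / r + 2 * s' \<ge> 1" using r rs by simp
  thus "1 / r + 2 * (1 + (s - 1) / r) \<ge> 1" by (simp add: s'_def)
  have Wf: "wcomp k r s f \<in> hcarrier H" by (rule wcomp_mem[OF r rs f])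
  define V where "V = wcomp (k * r powr (- \<beta>)) (1 / r) s'"
  have VC: "V h \<in> hcarrier H" if "h \<in> hcarrier H" for h unfolding V_def by (rule wcomp_mem[OF r' rs' that])
  show "hinner H (wcomp k r s f) g = hinner H f (wcomp (k * r powr (- \<beta>)) (1 / r) (1 + (s - 1) / r) g)"
    unfolding s'_def[symmetric] V_def[symmetric] using g
  proof (induction rule: kernel_induct)
    case (kernel d)
    hence d: "d > -1/2" by simp
    have e: "(s' + d) / (1 / r) = r * d + r + s - 1" using r by (simp add: s'_def field_simps)
    have kk: "k * r powr (- \<beta>) * (1 / r) powr (- \<beta>) = k"
      using r by (simp add: powr_divide powr_minus)
    have "V (ekern d) = (\<lambda>z. of_real k * ekern (r * d + r + s - 1) z)"
      unfolding V_def wcomp_ekern(1)[OF r' rs' d] e kk ..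
    thus ?case
      using inner_wcomp_ekern[OF r rs d f Wf] by (simp add: inner_scale_right ekern_mem f)
  next
    case (add g h)
    thus ?case using Wf f VC by (simp add: inner_add_right V_def wcomp_add)
  next
    case (scale c g)
    thus ?case using Wf f VC by (simp add: inner_scale_right V_def wcomp_scale)
  next
    case (limit F g)
    have "(\<lambda>j. hinner H (wcomp k r s f) (F j)) \<longlonglongrightarrow> hinner H (wcomp k r s f) g"
      by (intro inner_tendsto Wf limit)
    moreover have "(\<lambda>j. hinner H f (V (F j))) \<longlonglongrightarrow> hinner H f (V g)"
      unfolding V_def by (intro inner_tendsto f wcomp_tendsto wcomp_mem r' rs' limit)
    ultimately show ?case unfolding limit.IH by (rule LIMSEQ_unique)
  qed
qed

lemma wcomp_compose:
  assumes r: "r > 0" and rs: "r + 2 * s \<ge> 1" and r': "r' > 0" and rs': "r' + 2 * s' \<ge> 1"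
  shows "wcomp k r s \<circ> wcomp k' r' s' = wcomp (k * k') (r * r') (r' * s + s')"
    and "r * r' > 0" and "r * r' + 2 * (r' * s + s') \<ge> 1"
proof -
  show "wcomp k r s \<circ> wcomp k' r' s' = wcomp (k * k') (r * r') (r' * s + s')"
  proof
    fix f
    have "wcomp k' r' s' f \<in> hcarrier H"
      by (cases "f \<in> hcarrier H") (simp_all add: wcomp_mem[OF r' rs'] wcomp_off zero_mem)
    thus "(wcomp k r s \<circ> wcomp k' r' s') f = wcomp (k * k') (r * r') (r' * s + s') f"
      using wcomp_comp[OF r rs r' rs'] by simp
  qed
  show "r * r' > 0" using r r' by simp
  have "r' * 1 \<le> r' * (r + 2 * s)" using rs r' by (intro mult_left_mono) auto
  thus "r * r' + 2 * (r' * s + s') \<ge> 1" using rs' by (simp add: algebra_simps)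
qed

section \<open>The Aluthge transform of a weighted composition operator\<close>

lemma adjoint_wcomp:
  assumes "r > 0" "r + 2 * s \<ge> 1"
  shows "adjoint_op H (wcomp k r s) = wcomp (k * r powr (- \<beta>)) (1 / r) (1 + (s - 1) / r)"
  using inner_wcomp[OF assms] zero_mem assms by (intro adjoint_opI bounded_op_wcomp) auto

lemma adjoint_wcomp_comp_wcomp:
  assumes "r > 0" "r + 2 * s \<ge> 1"
  shows "adjoint_op H (wcomp k r s) \<circ> wcomp k r s = wcomp (k\<^sup>2 * r powr (- \<beta>)) 1 (r + 2 * s - 1)"
proof -
  have "wcomp (k * r powr (- \<beta>)) (1 / r) (1 + (s - 1) / r) \<circ> wcomp k r s
      = wcomp (k * r powr (- \<beta>) * k) (1 / r * r) (r * (1 + (s - 1) / r) + s)"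
    by (rule wcomp_compose(1)) (use assms inner_wcomp(2)[OF assms zero_mem zero_mem] in auto)
  moreover have "r * (1 + (s - 1) / r) + s = r + 2 * s - 1" "1 / r * r = 1"
    "k * r powr (- \<beta>) * k = k\<^sup>2 * r powr (- \<beta>)"
    using assms by (simp_all add: field_simps power2_eq_square)
  ultimately show ?thesis unfolding adjoint_wcomp[OF assms] by (simp only:)
qed

lemma hnorm_wcomp_sq:
  assumes r: "r > 0" and rs: "r + 2 * s \<ge> 1" and f: "f \<in> hcarrier H"
  shows "(hnorm H (wcomp k r s f))\<^sup>2 = Re (hinner H f (wcomp (k\<^sup>2 * r powr (- \<beta>)) 1 (r + 2 * s - 1) f))"
proof -
  have "hinner H (wcomp k r s f) (wcomp k r s f) = hinner H f ((adjoint_op H (wcomp k r s) \<circ> wcomp k r s) f)"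
    using inner_wcomp[OF r rs f wcomp_mem[OF r rs f]] by (simp add: adjoint_wcomp[OF r rs])
  thus ?thesis
    unfolding adjoint_wcomp_comp_wcomp[OF r rs] by (simp add: hnorm_sq wcomp_mem[OF r rs f])
qed

lemma wcomp_translation_compose:
  assumes "s \<ge> 0" "t \<ge> 0"
  shows "wcomp k 1 s \<circ> wcomp l 1 t = wcomp (k * l) 1 (s + t)"
  using wcomp_compose(1)[of 1 s 1 t] assms by simp

text \<open>
  A translation is the square of the symmetric translation by half the amount.
\<close>

lemma positive_op_translation:
  assumes k: "k \<ge> 0" and s: "s \<ge> 0"
  shows "positive_op H (wcomp k 1 s)"
  unfolding positive_op_def
proof (intro conjI ballI)
  show "bounded_op H (wcomp k 1 s)" using s by (intro bounded_op_wcomp) auto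
  fix f assume f: "f \<in> hcarrier H"
  define V where "V = wcomp (sqrt k) 1 (s / 2)"
  have Vf: "V f \<in> hcarrier H" unfolding V_def using s f by (intro wcomp_mem) auto
  have "wcomp k 1 s = V \<circ> V"
    unfolding V_def using wcomp_translation_compose[of "s / 2" "s / 2"] s k by simp
  hence "hinner H (wcomp k 1 s f) f = hinner H (V f) (V f)"
    using inner_wcomp(1)[of 1 "s / 2" "V f" f "sqrt k"] s f Vf by (simp add: V_def)
  thus "hinner H (wcomp k 1 s f) f \<in> \<real>\<^sub>\<ge>\<^sub>0"
    using Vf by (simp only: inner_self nonneg_Reals_of_real_iff zero_le_power2)
qed

lemma sqrt_translation:
  assumes "k \<ge> 0" "s \<ge> 0"
  shows "sqrt_op H (wcomp k 1 s) = wcomp (sqrt k) 1 (s / 2)"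
  using assms wcomp_translation_compose[of "s / 2" "s / 2" "sqrt k" "sqrt k"]
  by (intro sqrt_opI positive_op_translation) auto

lemma abs_wcomp:
  assumes k: "k \<ge> 0" and r: "r > 0" and rs: "r + 2 * s \<ge> 1"
  shows "abs_op H (wcomp k r s) = wcomp (k * r powr (- \<beta> / 2)) 1 ((r + 2 * s - 1) / 2)"
proof -
  have "k\<^sup>2 * r powr (- \<beta>) = (k * r powr (- \<beta> / 2))\<^sup>2"
    by (simp add: power2_eq_square flip: powr_add)
  hence "sqrt (k\<^sup>2 * r powr (- \<beta>)) = k * r powr (- \<beta> / 2)"
    using k by (metis real_sqrt_unique mult_nonneg_nonneg powr_ge_zero)
  thus ?thesis
    unfolding abs_op_def adjoint_wcomp_comp_wcomp[OF r rs] using rs by (subst sqrt_translation) auto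
qed

lemma symmetric_shift: "r + 2 * ((1 - r) / 2) = (1::real)"
  by (simp add: field_simps)

text \<open>
  For \<open>r + 2 s = 1\<close> the affine map preserves the boundary line of the half-plane, and the translation
  occurring in \<open>T\<^sup>* T\<close> is the one by \<open>0\<close>.
\<close>

lemma isometry_wcomp:
  assumes r: "r > 0" and f: "f \<in> hcarrier H"
  shows "hnorm H (wcomp (r powr (\<beta> / 2)) r ((1 - r) / 2) f) = hnorm H f"
proof -
  have "(r powr (\<beta> / 2))\<^sup>2 * r powr (- \<beta>) = 1"
    using r by (simp add: power2_eq_square flip: powr_add)
  hence "(hnorm H (wcomp (r powr (\<beta> / 2)) r ((1 - r) / 2) f))\<^sup>2 = Re (hinner H f (wcomp 1 1 0 f))"
    using hnorm_wcomp_sq[OF r _ f, of "(1 - r) / 2" "r powr (\<beta> / 2)", unfolded symmetric_shift] by simp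
  hence "(hnorm H (wcomp (r powr (\<beta> / 2)) r ((1 - r) / 2) f))\<^sup>2 = (hnorm H f)\<^sup>2"
    using f by (simp add: wcomp_1_0 hnorm_sq)
  thus ?thesis
    by (rule power2_eq_imp_eq) (intro hnorm_ge_0 wcomp_mem r f; simp only: symmetric_shift)+
qed

text \<open>
  The range contains \<open>ekern d\<close> for all \<open>d > s - 1/2\<close>. The parameters occurring in \<open>kernel_induct\<close>
  are moved into that region by a multiple of the unitary operator with a small dilation factor \<open>r\<close>. As
  this operator is bounded and onto, it carries a dense span to a dense span.
\<close>

lemma translation_range_dense:
  assumes k: "k \<noteq> 0" and s: "s \<ge> 0" and f: "f \<in> hcarrier H"
  shows "approximable (wcomp k 1 s ` hcarrier H) f"
proof -
  define S where "S = wcomp k 1 s ` hcarrier H"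
  have v: "1 + 2 * s \<ge> 1" using s by simp
  have S: "S \<subseteq> hcarrier H" unfolding S_def using wcomp_mem[of 1 s] v by auto
  have Sadd: "(\<lambda>z. g z + h z) \<in> S" if mem: "g \<in> S" "h \<in> S" for g h
  proof -
    obtain g' h' where gh: "g' \<in> hcarrier H" "h' \<in> hcarrier H" "g = wcomp k 1 s g'" "h = wcomp k 1 s h'"
      using mem by (auto simp: S_def)
    thus ?thesis unfolding S_def by (intro image_eqI[of _ _ "\<lambda>z. g' z + h' z"]) (auto simp: wcomp_add add_mem)
  qed
  have Sscale: "(\<lambda>z. c * g z) \<in> S" if mem: "g \<in> S" for c g
  proof -
    obtain g' where gh: "g' \<in> hcarrier H" "g = wcomp k 1 s g'"
      using mem by (auto simp: S_def)
    thus ?thesis unfolding S_def by (intro image_eqI[of _ _ "\<lambda>z. c * g' z"]) (auto simp: wcomp_scale scale_mem)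
  qed
  \<comment> \<open>Chosen so that \<open>c \<ge> 0\<close> is moved to at least \<open>s + 1/2\<close>.\<close>
  define r where "r = 1 / (2 * (s + 1))"
  define Q where "Q = wcomp 1 r ((1 - r) / 2)"
  have r: "r > 0" "r + 2 * ((1 - r) / 2) \<ge> 1" using s by (simp add: r_def) (simp only: symmetric_shift)
  have Q: "approximable S (Q g)" if "g \<in> hcarrier H" for g
    using that
  proof (induction rule: kernel_induct)
    case (kernel c)
    hence c: "c > -1/2" by simp
    define d where "d = ((1 - r) / 2 + c) / r - s"
    have "((1 - r) / 2 + c) / r = (1 / r - 1) / 2 + c / r" using r by (simp add: field_simps)
    also have "(1 / r - 1) / 2 = 1 / 2 + s" using s by (simp add: r_def field_simps)
    finally have "d = 1 / 2 + c / r" by (simp add: d_def)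
    hence d: "d > -1/2" using kernel r by (simp add: add_pos_nonneg)
    have "wcomp k 1 s (ekern d) = (\<lambda>z. of_real k * ekern ((s + d) / 1) z)"
      using wcomp_ekern(1)[of 1 s d k] v d by simp
    hence "ekern (s + d) = (\<lambda>z. inverse (of_real k) * wcomp k 1 s (ekern d) z)" using k by (simp add: fun_eq_iff)
    moreover have "s + d = ((1 - r) / 2 + c) / r" by (simp add: d_def)
    ultimately have "ekern (((1 - r) / 2 + c) / r) \<in> S"
      using Sscale[of "wcomp k 1 s (ekern d)"] ekern_mem[OF d] by (simp add: S_def)
    hence "Q (ekern c) \<in> S" unfolding Q_def wcomp_ekern(1)[OF r c] by (rule Sscale)
    thus ?case by (rule approximable_self)
  next
    case (add g h)
    thus ?case using S Sadd approximable_add[of S "Q g" "Q h"] by (simp add: Q_def wcomp_add wcomp_mem[OF r])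
  next
    case (scale c g)
    thus ?case using S Sscale approximable_scale[of S c "Q g"] by (simp add: Q_def wcomp_scale wcomp_mem[OF r])
  next
    case (limit F g)
    show ?case
      by (rule approximable_limit[OF S, of "\<lambda>j. Q (F j)"])
         (use limit r in \<open>auto simp: Q_def intro!: wcomp_mem wcomp_tendsto\<close>)
  qed
  have r': "1 / r > 0" "1 / r + 2 * ((1 - 1 / r) / 2) \<ge> 1" using r by simp (simp only: symmetric_shift)
  have "Q \<circ> wcomp 1 (1 / r) ((1 - 1 / r) / 2) = wcomp 1 1 0"
    unfolding Q_def wcomp_compose(1)[OF r r'] using r by (simp add: field_simps)
  hence "Q (wcomp 1 (1 / r) ((1 - 1 / r) / 2) f) = f" using wcomp_1_0[OF f] by (metis comp_apply)
  thus ?thesis using Q[OF wcomp_mem[OF r' f, of 1]] by (simp add: S_def)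
qed

text \<open>
  A vector in the kernel of a self-adjoint operator is orthogonal to its range, which is dense.
\<close>

lemma translation_injective:
  assumes k: "k \<noteq> 0" and s: "s \<ge> 0" and f: "f \<in> hcarrier H" and eq: "wcomp k 1 s f = (\<lambda>_. 0)"
  shows "f = (\<lambda>_. 0)"
proof (rule hnorm_eq_0[OF f])
  have v: "1 + 2 * s \<ge> 1" using s by simp
  have "hnorm H f \<le> 0 + e" if e: "e > 0" for e
  proof -
    obtain g where g: "g \<in> hcarrier H" "hnorm H (\<lambda>z. f z - wcomp k 1 s g z) < e"
      using translation_range_dense[OF k s f] e unfolding approximable_def by blast
    have Wg: "wcomp k 1 s g \<in> hcarrier H" using wcomp_mem[of 1 s g k] v g by simp
    have "hinner H f (wcomp k 1 s g) = hinner H (wcomp k 1 s f) g"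
      using inner_wcomp(1)[of 1 s f g k] v f g by simp
    hence "hinner H f f = hinner H f (\<lambda>z. f z - wcomp k 1 s g z)"
      using eq g f Wg by (simp add: inner_zero_left inner_diff_right)
    hence "(hnorm H f)\<^sup>2 \<le> cmod (hinner H f (\<lambda>z. f z - wcomp k 1 s g z))"
      using hnorm_sq[OF f] complex_Re_le_cmod[of "hinner H f f"] by simp
    also have "\<dots> \<le> hnorm H f * hnorm H (\<lambda>z. f z - wcomp k 1 s g z)"
      by (intro Cauchy_Schwarz f diff_mem Wg)
    also have "\<dots> \<le> hnorm H f * e" using g by (intro mult_left_mono hnorm_ge_0 f) auto
    finally show ?thesis using e hnorm_ge_0[OF f] by (cases "hnorm H f = 0") (auto simp: power2_eq_square)
  qed
  hence "hnorm H f \<le> 0" by (rule field_le_epsilon)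
  thus "hnorm H f = 0" using hnorm_ge_0[OF f] by simp
qed

lemma polar_part_wcomp:
  assumes k: "k > 0" and r: "r > 0" and rs: "r + 2 * s \<ge> 1"
  shows "polar_part H (wcomp k r s) = wcomp (r powr (\<beta> / 2)) r ((1 - r) / 2)"
proof -
  define t where "t = (r + 2 * s - 1) / 2"
  have t: "t \<ge> 0" using rs by (simp add: t_def)
  define l where "l = k * r powr (- \<beta> / 2)"
  have l: "l \<noteq> 0" using k r by (simp add: l_def)
  have A: "abs_op H (wcomp k r s) = wcomp l 1 t" using abs_wcomp[of k r s] k r rs by (simp add: t_def l_def)
  have lk: "r powr (\<beta> / 2) * l = k" using r by (simp add: l_def flip: powr_add)
  show ?thesis
  proof (rule polar_partI)
    show "bounded_op H (wcomp (r powr (\<beta> / 2)) r ((1 - r) / 2))" by (intro bounded_op_wcomp r) (simp only: symmetric_shift)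
    show "bounded_op H (abs_op H (wcomp k r s))" unfolding A using t by (intro bounded_op_wcomp) auto
    show "wcomp k r s = wcomp (r powr (\<beta> / 2)) r ((1 - r) / 2) \<circ> abs_op H (wcomp k r s)"
    proof -
      have "(1 - r) / 2 + t = s" by (simp add: t_def field_simps)
      thus ?thesis
        unfolding A using wcomp_compose(1)[OF r _ zero_less_one, of "(1 - r) / 2" t "r powr (\<beta> / 2)" l,
            unfolded symmetric_shift] t lk by simp
    qed
    show "\<exists>g\<in>hcarrier H. hnorm H (\<lambda>x. f x - abs_op H (wcomp k r s) g x) < e"
      if "f \<in> hcarrier H" "e > 0" for f e
      using translation_range_dense[OF l t that(1)] that(2) unfolding A approximable_def by blast
    show "f = (\<lambda>_. 0)" if "f \<in> hcarrier H" "abs_op H (wcomp k r s) f = (\<lambda>_. 0)" for f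
      using translation_injective[OF l t] that unfolding A by blast
  qed (rule isometry_wcomp[OF r])
qed

text \<open>
  Moving the translation by \<open>t\<close> from the left of the unitary factor to its right turns it into one
  by \<open>r t\<close>; together with the translation by \<open>t\<close> already there this gives \<open>(1 + r) t\<close>.
\<close>

lemma aluthge_wcomp:
  assumes k: "k > 0" and r: "r > 0" and rs: "r + 2 * s \<ge> 1"
  defines "t \<equiv> (r + 2 * s - 1) / 4"
  shows "aluthge H (wcomp k r s) = wcomp k r ((1 - r) / 2 + (1 + r) * t)"
proof -
  have t: "t \<ge> 0" using rs by (simp add: t_def)
  define l where "l = k * r powr (- \<beta> / 2)"
  have l: "l \<ge> 0" using k r by (simp add: l_def)
  have "(r + 2 * s - 1) / 2 = 2 * t" by (simp add: t_def)
  hence "abs_op H (wcomp k r s) = wcomp l 1 (2 * t)"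
    using abs_wcomp[of k r s] k r rs by (simp only: l_def)
  hence "sqrt_op H (abs_op H (wcomp k r s)) = wcomp (sqrt l) 1 t"
    using sqrt_translation[of l "2 * t"] l t by simp
  hence "aluthge H (wcomp k r s) = wcomp (sqrt l) 1 t \<circ> wcomp (r powr (\<beta> / 2)) r ((1 - r) / 2) \<circ> wcomp (sqrt l) 1 t"
    unfolding aluthge_def polar_part_wcomp[OF k r rs] by simp
  also have "wcomp (sqrt l) 1 t \<circ> wcomp (r powr (\<beta> / 2)) r ((1 - r) / 2)
      = wcomp (sqrt l * r powr (\<beta> / 2)) r (r * t + (1 - r) / 2)"
    using wcomp_compose(1)[OF zero_less_one _ r, of t "(1 - r) / 2", unfolded symmetric_shift] t by simp
  also have "\<dots> \<circ> wcomp (sqrt l) 1 t = wcomp (sqrt l * r powr (\<beta> / 2) * sqrt l) r (r * t + (1 - r) / 2 + t)"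
  proof -
    have "1 \<le> r + 2 * (r * t + (1 - r) / 2)" using r t by (simp add: field_simps)
    thus ?thesis using wcomp_compose(1)[OF r _ zero_less_one, of "r * t + (1 - r) / 2" t] t by simp
  qed
  also have "sqrt l * r powr (\<beta> / 2) * sqrt l = r powr (\<beta> / 2) * l" using l by simp
  also have "\<dots> = k" using r by (simp add: l_def flip: powr_add)
  finally show ?thesis by (simp add: algebra_simps)
qed

text \<open>
  Half of \<open>r + 2 s - 1\<close> is the distance by which the affine map pushes the boundary line inwards, and every
  step multiplies it by \<open>(1 + r) / 2\<close>.
\<close>

lemma iterated_aluthge_wcomp:
  assumes k: "k > 0" and r: "r > 0" and rs: "r + 2 * s \<ge> 1"
  shows "iterated_aluthge H (wcomp k r s) n = wcomp k r ((1 - r) / 2 + ((1 + r) / 2) ^ n * (r + 2 * s - 1) / 2)"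
proof (induction n)
  case 0
  show ?case by (simp add: field_simps)
next
  case (Suc n)
  define u where "u = ((1 + r) / 2) ^ n * (r + 2 * s - 1) / 2"
  have u: "u \<ge> 0" using r rs by (simp add: u_def)
  have "iterated_aluthge H (wcomp k r s) (Suc n) = aluthge H (wcomp k r ((1 - r) / 2 + u))"
    by (simp add: Suc u_def)
  also have "\<dots> = wcomp k r ((1 - r) / 2 + (1 + r) * (u / 2))"
    using aluthge_wcomp[OF k r, of "(1 - r) / 2 + u"] u by (simp add: field_simps)
  also have "(1 + r) * (u / 2) = ((1 + r) / 2) ^ Suc n * (r + 2 * s - 1) / 2"
    by (simp add: u_def)
  finally show ?case .
qed

section \<open>Strong convergence without norm convergence\<close>

lemma translation_tendsto_0:
  assumes f: "f \<in> hcarrier H"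
  shows "((\<lambda>s. hnorm H (wcomp 1 1 s f)) \<longlongrightarrow> 0) at_top"
  using f
proof (induction rule: kernel_induct)
  case (kernel c)
  have "filterlim (\<lambda>s. (1 + 2 * c) + 2 * s) at_top at_top"
    by (intro filterlim_tendsto_add_at_top[OF tendsto_const]
        filterlim_tendsto_pos_mult_at_top[OF tendsto_const _ filterlim_ident]) auto
  hence "filterlim (\<lambda>s. 1 + 2 * (s + c)) at_top at_top" by (simp add: algebra_simps)
  hence "((\<lambda>s. (1 + 2 * (s + c)) powr (- \<beta> / 2)) \<longlongrightarrow> 0) at_top"
    using beta_gt_1 by (intro tendsto_neg_powr) auto
  moreover have "\<forall>\<^sub>F s in at_top. (1 + 2 * (s + c)) powr (- \<beta> / 2) = hnorm H (wcomp 1 1 s (ekern c))"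
  proof (rule eventually_mono[OF eventually_ge_at_top[of 0]])
    fix s :: real assume s: "s \<ge> 0"
    have "wcomp 1 1 s (ekern c) = ekern (s + c)" using wcomp_ekern(1)[of 1 s c 1] s kernel by simp
    thus "(1 + 2 * (s + c)) powr (- \<beta> / 2) = hnorm H (wcomp 1 1 s (ekern c))"
      using s kernel by (simp add: hnorm_ekern)
  qed
  ultimately show ?case by (rule Lim_transform_eventually)
next
  case (add f g)
  have "((\<lambda>s. hnorm H (wcomp 1 1 s f) + hnorm H (wcomp 1 1 s g)) \<longlongrightarrow> 0 + 0) at_top"
    by (intro tendsto_add add)
  hence lim: "((\<lambda>s. hnorm H (wcomp 1 1 s f) + hnorm H (wcomp 1 1 s g)) \<longlongrightarrow> 0) at_top" by simp
  have "\<forall>\<^sub>F s in at_top. norm (hnorm H (wcomp 1 1 s (\<lambda>z. f z + g z))) \<le> hnorm H (wcomp 1 1 s f) + hnorm H (wcomp 1 1 s g)"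
  proof (rule eventually_mono[OF eventually_ge_at_top[of 0]])
    fix s :: real assume s: "s \<ge> 0"
    have "wcomp 1 1 s f \<in> hcarrier H" "wcomp 1 1 s g \<in> hcarrier H" using s add by (auto intro!: wcomp_mem)
    thus "norm (hnorm H (wcomp 1 1 s (\<lambda>z. f z + g z))) \<le> hnorm H (wcomp 1 1 s f) + hnorm H (wcomp 1 1 s g)"
      using add by (simp add: wcomp_add hnorm_triangle hnorm_ge_0 add_mem)
  qed
  thus ?case using lim by (rule Lim_null_comparison)
next
  case (scale c f)
  have "((\<lambda>s. cmod c * hnorm H (wcomp 1 1 s f)) \<longlongrightarrow> cmod c * 0) at_top"
    by (intro tendsto_mult tendsto_const scale)
  moreover have "\<forall>\<^sub>F s in at_top. cmod c * hnorm H (wcomp 1 1 s f) = hnorm H (wcomp 1 1 s (\<lambda>z. c * f z))"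
  proof (rule eventually_mono[OF eventually_ge_at_top[of 0]])
    fix s :: real assume s: "s \<ge> 0"
    have "wcomp 1 1 s f \<in> hcarrier H" using s scale by (auto intro!: wcomp_mem)
    thus "cmod c * hnorm H (wcomp 1 1 s f) = hnorm H (wcomp 1 1 s (\<lambda>z. c * f z))"
      using scale by (simp add: wcomp_scale hnorm_scale)
  qed
  ultimately show ?case using Lim_transform_eventually by fastforce
next
  case (limit F f)
  show ?case
  proof (rule tendstoI)
    fix e :: real assume e: "e > 0"
    have "eventually (\<lambda>k. hnorm H (\<lambda>z. F k z - f z) < e / 2) sequentially"
      using e by (intro order_tendstoD(2)[OF limit.hyps(3)]) auto
    then obtain k where k: "hnorm H (\<lambda>z. F k z - f z) < e / 2"
      by (auto simp: eventually_sequentially)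
    have "eventually (\<lambda>s. hnorm H (wcomp 1 1 s (F k)) < e / 2) at_top"
      using e by (intro order_tendstoD(2)[OF limit.IH]) auto
    thus "eventually (\<lambda>s. dist (hnorm H (wcomp 1 1 s f)) 0 < e) at_top"
      using eventually_ge_at_top[of 0]
    proof eventually_elim
      case (elim s)
      have m: "wcomp 1 1 s f \<in> hcarrier H" "wcomp 1 1 s (F k) \<in> hcarrier H"
        using elim limit by (auto intro!: wcomp_mem)
      have "hnorm H (wcomp 1 1 s f) \<le> hnorm H (wcomp 1 1 s (F k)) + hnorm H (\<lambda>z. wcomp 1 1 s f z - wcomp 1 1 s (F k) z)"
        by (rule hnorm_le_add_diff[OF m])
      also have "(\<lambda>z. wcomp 1 1 s f z - wcomp 1 1 s (F k) z) = wcomp 1 1 s (\<lambda>z. f z - F k z)"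
        using limit by (simp add: wcomp_diff)
      also have "hnorm H (wcomp 1 1 s (\<lambda>z. f z - F k z)) \<le> hnorm H (\<lambda>z. f z - F k z)"
        using wcomp_norm_le[of 1 s "\<lambda>z. f z - F k z" 1] elim limit by (simp add: diff_mem)
      also have "\<dots> < e / 2" using k hnorm_diff_commute[of f "F k"] limit by simp
      finally show ?case using elim m by (simp add: hnorm_ge_0)
    qed
  qed
qed

lemma hnorm_wcomp_ekern:
  assumes r: "r > 0" and rs: "r + 2 * s \<ge> 1" and c: "c > -1/2"
  shows "hnorm H (wcomp k r s (ekern c)) = \<bar>k\<bar> * r powr (- \<beta> / 2) * (r + 2 * (s + c)) powr (- \<beta> / 2)"
proof -
  note d = wcomp_ekern(2)[OF r rs c]
  have "r powr (- \<beta>) = r powr (- \<beta> / 2) * r powr (- \<beta> / 2)" by (simp flip: powr_add)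
  moreover have "r powr (- \<beta> / 2) * (1 + 2 * ((s + c) / r)) powr (- \<beta> / 2) = (r + 2 * (s + c)) powr (- \<beta> / 2)"
  proof -
    have "r * (1 + 2 * ((s + c) / r)) = r + 2 * (s + c)" using r by (simp add: field_simps)
    thus ?thesis using powr_mult[of r "1 + 2 * ((s + c) / r)" "- \<beta> / 2"] by simp
  qed
  ultimately show ?thesis
    unfolding wcomp_ekern(1)[OF r rs c] hnorm_scale[OF ekern_mem[OF d]] hnorm_ekern[OF d]
    by (simp add: norm_mult mult.assoc)
qed

text \<open>
  As \<open>1 - \<phi> z = a (1 - z)\<close>, the symbol is the dilation by \<open>1 / a\<close> in the half-plane coordinate. The
  weight is constant, and the scalar cancels it.
\<close>

lemma composition_op_affine:
  assumes a: "0 < a"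
  shows "composition_op H (\<lambda>z. complex_of_real a * z + (1 - complex_of_real a)) = wcomp ((1 / a) powr \<beta>) (1 / a) 0"
proof (intro ext)
  fix h z
  have "complex_of_real ((1 / a) powr \<beta>) * of_real (1 / a) powr (- of_real \<beta>) = of_real ((1 / a) powr \<beta> * (1 / a) powr (- \<beta>))"
    using powr_of_real[of "1 / a" "- \<beta>"] a by simp
  also have "(1 / a) powr \<beta> * (1 / a) powr (- \<beta>) = 1" using a by (simp flip: powr_add)
  finally have "complex_of_real ((1 / a) powr \<beta>) * of_real (1 / a) powr (- of_real \<beta>) = 1" by simp
  moreover have "disk_affine (1 / a) 0 z = of_real a * z + (1 - of_real a)"
    using a by (simp add: disk_affine_def algebra_simps)
  ultimately show "composition_op H (\<lambda>z. complex_of_real a * z + (1 - complex_of_real a)) h z = wcomp ((1 / a) powr \<beta>) (1 / a) 0 h z"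
    by (simp add: composition_op_def wcomp_def)
qed

end

theorem theorem3p1:
  fixes a \<alpha> :: real and \<phi> :: "complex \<Rightarrow> complex"
  assumes "0 < a" and "a < 1" and "\<alpha> > -1"
    and "\<phi> = (\<lambda>z. complex_of_real a * z + (1 - complex_of_real a))"
  defines "X \<equiv> iterated_aluthge (bergman \<alpha>) (composition_op (bergman \<alpha>) \<phi>)"
  shows "sot_tendsto (bergman \<alpha>) X (\<lambda>_ _. 0) \<and>
    \<not> (\<exists>L. bounded_op (bergman \<alpha>) L \<and> norm_tendsto (bergman \<alpha>) X L)"
proof -
  interpret bergman_space \<alpha> by unfold_locales (rule assms)
  define r where "r = 1 / a"
  have r1: "r > 1" using assms by (simp add: r_def)
  hence r: "r > 0" by simp
  define k where "k = r powr \<beta>"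
  have k: "k > 0" using r by (simp add: k_def)
  define t where "t n = ((1 + r) / 2) ^ n * (r - 1)" for n
  define s where "s n = (1 - r) / 2 + t n / 2" for n
  have t: "t n \<ge> 0" for n using r1 by (simp add: t_def)
  have rst: "r + 2 * s n = 1 + t n" for n
  proof -
    have "r + 2 * s n = (r + 2 * ((1 - r) / 2)) + t n" unfolding s_def by (simp only: distrib_left)
    thus ?thesis unfolding symmetric_shift .
  qed
  hence rs: "r + 2 * s n \<ge> 1" for n using t[of n] by simp
  have X: "X n = wcomp k r (s n)" for n
    using iterated_aluthge_wcomp[OF k r, of 0 n] r1 composition_op_affine[OF assms(1)]
    by (simp add: X_def assms(4) r_def[symmetric] k_def[symmetric] s_def t_def)
  have bX: "bounded_op H (X n)" for n unfolding X by (rule bounded_op_wcomp[OF r rs])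
  have t_lim: "filterlim t at_top sequentially"
  proof -
    have "filterlim (\<lambda>n. ((1 + r) / 2) ^ n) at_top sequentially"
      using r1 by (intro filterlim_at_infinity_imp_filterlim_at_top filterlim_realpow_sequentially_gt1
          always_eventually) auto
    thus ?thesis unfolding t_def using r1
      by (intro filterlim_at_top_mult_tendsto_pos[OF tendsto_const]) auto
  qed
  have normX: "hnorm H (X n f) = r powr (\<beta> / 2) * hnorm H (wcomp 1 1 (t n / 2) f)" if f: "f \<in> hcarrier H" for n f
  proof -
    have m: "wcomp 1 1 (t n / 2) f \<in> hcarrier H" using t f by (intro wcomp_mem) auto
    have "r powr (\<beta> / 2) * r powr (\<beta> / 2) = k" using r by (simp add: k_def flip: powr_add)
    moreover have "wcomp (r powr (\<beta> / 2)) r ((1 - r) / 2) \<circ> wcomp (r powr (\<beta> / 2)) 1 (t n / 2)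
        = wcomp (r powr (\<beta> / 2) * r powr (\<beta> / 2)) (r * 1) (1 * ((1 - r) / 2) + t n / 2)"
    proof (rule wcomp_compose(1))
      show "r + 2 * ((1 - r) / 2) \<ge> 1" by (simp only: symmetric_shift)
    qed (use r t in auto)
    ultimately have "X n = wcomp (r powr (\<beta> / 2)) r ((1 - r) / 2) \<circ> wcomp (r powr (\<beta> / 2) * 1) 1 (t n / 2)"
      by (simp add: X s_def)
    hence "hnorm H (X n f) = hnorm H (wcomp (r powr (\<beta> / 2) * 1) 1 (t n / 2) f)"
      using isometry_wcomp[OF r wcomp_mem[of 1 "t n / 2" f]] t f by simp
    also have "\<dots> = r powr (\<beta> / 2) * hnorm H (wcomp 1 1 (t n / 2) f)"
      unfolding wcomp_scalar hnorm_scale[OF m] by simp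
    finally show ?thesis .
  qed
  have sot: "(\<lambda>n. hnorm H (X n f)) \<longlonglongrightarrow> 0" if f: "f \<in> hcarrier H" for f
  proof -
    have "filterlim (\<lambda>n. 1 / 2 * t n) at_top sequentially"
      by (intro filterlim_tendsto_pos_mult_at_top[OF tendsto_const] t_lim) auto
    hence "filterlim (\<lambda>n. t n / 2) at_top sequentially" by simp
    hence "(\<lambda>n. hnorm H (wcomp 1 1 (t n / 2) f)) \<longlonglongrightarrow> 0"
      by (rule filterlim_compose[OF translation_tendsto_0[OF f]])
    hence "(\<lambda>n. r powr (\<beta> / 2) * hnorm H (wcomp 1 1 (t n / 2) f)) \<longlonglongrightarrow> r powr (\<beta> / 2) * 0"
      by (intro tendsto_intros)
    thus ?thesis by (simp add: normX[OF f])
  qed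
  show ?thesis
  proof
    show "sot_tendsto H X (\<lambda>_ _. 0)" using sot by (simp add: sot_tendsto_def)
    show "\<not> (\<exists>L. bounded_op H L \<and> norm_tendsto H X L)"
    proof
      assume "\<exists>L. bounded_op H L \<and> norm_tendsto H X L"
      then obtain L where L: "bounded_op H L" and lim: "(\<lambda>n. op_norm H (\<lambda>f x. X n f x - L f x)) \<longlonglongrightarrow> 0"
        by (auto simp: norm_tendsto_def)
      have upper: "hnorm H (\<lambda>x. X n f x - L f x) \<le> op_norm H (\<lambda>f x. X n f x - L f x)"
        if f: "f \<in> hcarrier H" "hnorm H f \<le> 1" for n f
        by (rule hnorm_le_op_norm_diff[OF bX L f])
      \<comment> \<open>The norm limit agrees with the strong limit on the unit ball.\<close>
      have L0: "L f = (\<lambda>_. 0)" if f: "f \<in> hcarrier H" "hnorm H f \<le> 1" for f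
      proof (rule hnorm_eq_0)
        show m: "L f \<in> hcarrier H" by (rule bounded_op_mem[OF L f(1)])
        have "(\<lambda>n. hnorm H (X n f) + op_norm H (\<lambda>f x. X n f x - L f x)) \<longlonglongrightarrow> 0 + 0"
          by (intro tendsto_intros sot f lim)
        moreover have "hnorm H (L f) \<le> hnorm H (X n f) + op_norm H (\<lambda>f x. X n f x - L f x)" for n
          using hnorm_le_add_diff[OF m bounded_op_mem[OF bX f(1)], of n] upper[OF f, of n]
            hnorm_diff_commute[OF m bounded_op_mem[OF bX f(1)], of n] by simp
        ultimately have "hnorm H (L f) \<le> 0 + 0"
          by (intro tendsto_lowerbound[of _ "0 + 0" sequentially]) auto
        thus "hnorm H (L f) = 0" using hnorm_ge_0[OF m] by simp
      qed
      define \<delta> where "\<delta> = r powr (\<beta> / 2) * (1 / 2) powr (\<beta> / 2)"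
      have \<delta>: "\<delta> > 0" using r by (simp add: \<delta>_def)
      have "\<delta> \<le> op_norm H (\<lambda>f x. X n f x - L f x)" for n
      proof -
        \<comment> \<open>The function \<open>ekern c\<close> is shrunk by the translation by \<open>t n / 2\<close> only by the factor
          \<open>((1 + 2 c) / (1 + 2 c + t n)) powr (\<beta> / 2)\<close>. With \<open>c\<close> as large as \<open>t n\<close>
          this stays above \<open>(1 / 2) powr (\<beta> / 2)\<close> for all \<open>n\<close>.\<close>
        define c where "c = t n"
        have c: "c \<ge> 0" using t by (simp add: c_def)
        define N where "N = hnorm H (ekern c)"
        have N: "N = (1 + 2 * c) powr (- \<beta> / 2)" unfolding N_def using c by (intro hnorm_ekern) auto
        have N0: "N > 0" using N c by simp
        define f where "f = (\<lambda>z. complex_of_real (1 / N) * ekern c z)"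
        have f: "f \<in> hcarrier H" unfolding f_def using c by (intro scale_mem ekern_mem) auto
        have ecm: "ekern c \<in> hcarrier H" using c by (intro ekern_mem) auto
        have f1: "hnorm H f = 1" unfolding f_def hnorm_scale[OF ecm] using N0 by (simp add: N_def norm_divide)
        have "hnorm H (X n f) = hnorm H (X n (ekern c)) / N"
          unfolding f_def bounded_op_scale[OF bX ecm] hnorm_scale[OF bounded_op_mem[OF bX ecm]]
          using N0 by (simp add: norm_divide)
        also have "hnorm H (X n (ekern c)) = r powr (\<beta> / 2) * (1 + 3 * c) powr (- \<beta> / 2)"
        proof -
          have kr: "\<bar>k\<bar> * r powr (- \<beta> / 2) = r powr (\<beta> / 2)" using r by (simp add: k_def flip: powr_add)
          have e: "r + 2 * (s n + c) = 1 + 3 * c" using rst[of n] by (simp add: c_def)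
          have "hnorm H (wcomp k r (s n) (ekern c)) = \<bar>k\<bar> * r powr (- \<beta> / 2) * (r + 2 * (s n + c)) powr (- \<beta> / 2)"
            using c by (intro hnorm_wcomp_ekern r rs) auto
          thus ?thesis unfolding X kr e .
        qed
        finally have "hnorm H (X n f) = r powr (\<beta> / 2) * ((1 + 3 * c) powr (- \<beta> / 2) / (1 + 2 * c) powr (- \<beta> / 2))"
          by (simp add: N)
        also have "(1 + 3 * c) powr (- \<beta> / 2) / (1 + 2 * c) powr (- \<beta> / 2) = ((1 + 2 * c) / (1 + 3 * c)) powr (\<beta> / 2)"
          using c by (simp add: powr_divide powr_minus field_simps)
        finally have "hnorm H (X n f) = r powr (\<beta> / 2) * ((1 + 2 * c) / (1 + 3 * c)) powr (\<beta> / 2)" .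
        moreover have "(1 / 2) powr (\<beta> / 2) \<le> ((1 + 2 * c) / (1 + 3 * c)) powr (\<beta> / 2)"
          using c beta_gt_1 by (intro powr_mono2) (auto simp: field_simps)
        ultimately have "\<delta> \<le> hnorm H (X n f)" by (simp add: \<delta>_def mult_left_mono)
        also have "\<dots> \<le> op_norm H (\<lambda>f x. X n f x - L f x)"
          using upper[OF f, of n] f1 L0[OF f] by simp
        finally show ?thesis .
      qed
      hence "\<delta> \<le> 0" by (intro tendsto_lowerbound[OF lim]) auto
      thus False using \<delta> by simp
    qed
  qed
qed

end
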